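(* For a one-relator group $F/\langle\!\langle r\rangle\!\rangle$, where $F$ is a finitely generated free group and $r\in F$, neither the assumption that $r=[u,v]$ for some $u,v\in F$ nor the assumption that $r\in[F,F]$ implies Hopficity, residual finiteness, or automaticity of $F/\langle\!\langle r\rangle\!\rangle$. That is, for each property $P$ among "Hopfian", "residually finite", "automatic": there exist a finitely generated free group $F$ and an element $r\in F$ of the form $r=[u,v]$ with $u,v\in F$ such that $F/\langle\!\langle r\rangle\!\rangle$ does not have $P$; and there exist a finitely generated free group $F$ and an element $r\in[F,F]$ such that $F/\langle\!\langle r\rangle\!\rangle$ does not have $P$.
   Context: Commutator convention: $[x,y]:=x^{-1}y^{-1}xy$; $[F,F]$ is the commutator subgroup of $F$. $\langle\!\langle r\rangle\!\rangle$ denotes the normal closure of $r$ in $F$. A group is Hopfian if every surjective endomorphism of it is injective. A group is residually finite if the intersection of all its normal subgroups of finite index is trivial. Automatic group: an automatic structure on a group $G$ consists of a finite set $A$ of semigroup generators of $G$ (i.e. a finite alphabet $A$ with a map to $G$ whose image generates $G$ as a semigroup; for a word $w$ over $A$, $\overline{w}$ denotes the element of $G$ it represents), a finite state automaton $W$ over $A$, and finite state automata $M_x$ over $(A,A)$ for $x\in A\cup\{\epsilon\}$, where $\epsilon$ is the null string, such that: (i) the map $L(W)\to G$, $w\mapsto\overline{w}$, is surjective, where $L(W)$ is the language recognized by $W$; (ii) for each $x\in A\cup\{\epsilon\}$, $(w_1,w_2)\in L(M_x)$ if and only if $w_1,w_2\in L(W)$ and $\overline{w_1x}=\overline{w_2}$.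 Here an automaton over $(A,A)$ reads pairs of words $(w_1,w_2)$ over $A$ synchronously, letter by letter, the shorter word being padded at its end by an additional end-of-string symbol $\$\notin A$ so that both have equal length. A group is automatic if it admits an automatic structure. *)

theory Defs
  imports "HOL-Algebra.Algebra"
begin

section \<open>Free groups\<close>

text \<open>
  The free group on \<open>S\<close> is realised on reduced words. A letter \<open>(x, True)\<close> stands for
  the generator \<open>x\<close>, and \<open>(x, False)\<close> for its inverse.
\<close>

type_synonym 'a letter = "'a \<times> bool"

definition inv_letter :: "'a letter \<Rightarrow> 'a letter" where
  "inv_letter l = (fst l, \<not> snd l)"

definition reduced :: "'a letter list \<Rightarrow> bool" where
  "reduced w \<longleftrightarrow> successively (\<lambda>l m. m \<noteq> inv_letter l) w"

fun cons_cancel :: "'a letter \<Rightarrow> 'a letter list \<Rightarrow> 'a letter list" where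
  "cons_cancel l [] = [l]"
| "cons_cancel l (m # w) = (if m = inv_letter l then w else l # m # w)"

text \<open>For reduced words, the product below is the reduced form of their concatenation.\<close>

definition free_group :: "'a set \<Rightarrow> 'a letter list monoid" where
  "free_group S =
     \<lparr> carrier = {w. reduced w \<and> fst ` set w \<subseteq> S},
       monoid.mult = (\<lambda>v w. foldr cons_cancel v w),
       monoid.one = [] \<rparr>"

lemma inv_letter_simps [simp]:
  "inv_letter (inv_letter l) = l"
  "inv_letter l \<noteq> l"
  "fst (inv_letter l) = fst l"
  "inv_letter l = inv_letter m \<longleftrightarrow> l = m"
  by (auto simp: inv_letter_def prod_eq_iff)

lemma reduced_Nil [simp]: "reduced []"
  by (simp add: reduced_def)

lemma reduced_Cons: "reduced (l # w) \<longleftrightarrow> w = [] \<or> (hd w \<noteq> inv_letter l \<and> reduced w)"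
  by (auto simp: reduced_def successively_Cons)

lemma reduced_cons_cancel: "reduced w \<Longrightarrow> reduced (cons_cancel l w)"
  by (cases w) (auto simp: reduced_Cons)

lemma reduced_mult: "reduced w \<Longrightarrow> reduced (foldr cons_cancel v w)"
  by (induction v) (auto simp: reduced_cons_cancel)

lemma set_cons_cancel: "set (cons_cancel l w) \<subseteq> insert l (set w)"
  by (cases w) auto

lemma set_mult: "set (foldr cons_cancel v w) \<subseteq> set v \<union> set w"
  by (induction v) (use set_cons_cancel in fastforce)+

lemma cons_cancel_inv: "reduced w \<Longrightarrow> cons_cancel l (cons_cancel (inv_letter l) w) = w"
  by (cases w rule: remdups_adj.cases) (auto simp: reduced_Cons)

lemma cons_cancel_inv': "reduced w \<Longrightarrow> cons_cancel (inv_letter l) (cons_cancel l w) = w"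
  using cons_cancel_inv[of w "inv_letter l"] by simp

lemma mult_cons_cancel:
  "reduced w \<Longrightarrow> foldr cons_cancel (cons_cancel l v) w = cons_cancel l (foldr cons_cancel v w)"
  by (cases v) (auto simp: cons_cancel_inv reduced_mult)

lemma mult_assoc:
  "reduced w \<Longrightarrow>
     foldr cons_cancel (foldr cons_cancel u v) w = foldr cons_cancel u (foldr cons_cancel v w)"
  by (induction u) (auto simp: mult_cons_cancel)

lemma mult_inv:
  "reduced w \<Longrightarrow> foldr cons_cancel (rev (map inv_letter v)) (foldr cons_cancel v w) = w"
  by (induction v) (auto simp: cons_cancel_inv' reduced_mult)

lemma mult_Nil: "reduced v \<Longrightarrow> foldr cons_cancel v [] = v"
proof (induction v)
  case (Cons l v)
  then show ?case by (cases v) (auto simp: reduced_Cons)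
qed auto

lemma reduced_inv: "reduced v \<Longrightarrow> reduced (rev (map inv_letter v))"
  unfolding reduced_def successively_rev successively_map
  by (erule successively_mono) (metis inv_letter_simps(1))

lemma group_free_group: "group (free_group S)"
proof (rule groupI)
  fix u v assume "u \<in> carrier (free_group S)" "v \<in> carrier (free_group S)"
  then show "u \<otimes>\<^bsub>free_group S\<^esub> v \<in> carrier (free_group S)"
    using set_mult[of u v] by (fastforce simp: free_group_def reduced_mult)
next
  fix v assume v: "v \<in> carrier (free_group S)"
  show "\<exists>u\<in>carrier (free_group S). u \<otimes>\<^bsub>free_group S\<^esub> v = \<one>\<^bsub>free_group S\<^esub>"
  proof
    show "rev (map inv_letter v) \<in> carrier (free_group S)"
      using v by (auto simp: free_group_def reduced_inv)
    show "rev (map inv_letter v) \<otimes>\<^bsub>free_group S\<^esub> v = \<one>\<^bsub>free_group S\<^esub>"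
      using mult_inv[of "[]" v] v by (simp add: free_group_def mult_Nil)
  qed
qed (auto simp: free_group_def mult_assoc)

text \<open>The universal property of the free group.\<close>

theorem free_group_universal:
  assumes "group H" and "f \<in> S \<rightarrow> carrier H"
  shows "\<exists>\<phi>\<in>hom (free_group S) H. (\<forall>x\<in>S. \<phi> [(x, True)] = f x) \<and>
           (\<forall>\<psi>\<in>hom (free_group S) H. (\<forall>x\<in>S. \<psi> [(x, True)] = f x) \<longrightarrow>
              (\<forall>w\<in>carrier (free_group S). \<psi> w = \<phi> w))"
proof -
  interpret H: group H by fact
  interpret F: group "free_group S" by (rule group_free_group)
  define val where "val l = (if snd l then f (fst l) else inv\<^bsub>H\<^esub> f (fst l))" for l
  define \<phi> where "\<phi> w = foldr (\<lambda>l h. val l \<otimes>\<^bsub>H\<^esub> h) w \<one>\<^bsub>H\<^esub>" for w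
  have [simp]: "\<phi> [] = \<one>\<^bsub>H\<^esub>" "\<phi> (l # w) = val l \<otimes>\<^bsub>H\<^esub> \<phi> w" for l w
    by (auto simp: \<phi>_def)
  have valc: "val l \<in> carrier H" if "fst l \<in> S" for l
    using that assms(2) by (auto simp: val_def)
  have vali: "val (inv_letter l) = inv\<^bsub>H\<^esub> val l" if "fst l \<in> S" for l
    using that assms(2) by (auto simp: Pi_iff val_def inv_letter_def)
  have phic: "\<phi> w \<in> carrier H" if "fst ` set w \<subseteq> S" for w
    using that by (induction w) (auto simp: valc)
  have cc: "\<phi> (cons_cancel l w) = val l \<otimes>\<^bsub>H\<^esub> \<phi> w"
    if "fst l \<in> S" "fst ` set w \<subseteq> S" for l w
    using that by (cases w) (auto simp: vali valc phic H.m_assoc[symmetric])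
  have ph: "\<phi> (foldr cons_cancel v w) = \<phi> v \<otimes>\<^bsub>H\<^esub> \<phi> w"
    if "fst ` set w \<subseteq> S" "fst ` set v \<subseteq> S" for v w
    using that(2)
  proof (induction v)
    case Nil
    then show ?case by (simp add: phic that(1))
  next
    case (Cons l v)
    have "fst ` set (foldr cons_cancel v w) \<subseteq> S"
      using set_mult[of v w] Cons.prems that(1) by fastforce
    with Cons show ?case by (simp add: cc H.m_assoc valc phic that(1))
  qed
  have hom: "\<phi> \<in> hom (free_group S) H"
    by (rule homI) (auto simp: free_group_def ph phic)
  have gen: "\<phi> [(x, True)] = f x" if "x \<in> S" for x
    using that assms(2) by (auto simp: Pi_iff val_def)
  have uniq: "\<psi> w = \<phi> w"
    if psi: "\<psi> \<in> hom (free_group S) H" "\<forall>x\<in>S. \<psi> [(x, True)] = f x"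
      and w: "w \<in> carrier (free_group S)" for \<psi> w
  proof -
    interpret psi: group_hom "free_group S" H \<psi>
      by unfold_locales (rule psi)
    have letter: "\<psi> [l] = val l" if l: "fst l \<in> S" for l
    proof (cases "snd l")
      case True
      then show ?thesis using psi l by (cases l) (auto simp: val_def)
    next
      case False
      then obtain x where x: "l = (x, False)" "x \<in> S" using l by (cases l) auto
      have "inv\<^bsub>free_group S\<^esub> [(x, True)] = [(x, False)]"
        by (rule F.inv_equality) (use x in \<open>auto simp: free_group_def reduced_Cons inv_letter_def\<close>)
      moreover have "[(x, True)] \<in> carrier (free_group S)"
        using x by (auto simp: free_group_def reduced_Cons)
      ultimately have "\<psi> [l] = inv\<^bsub>H\<^esub> \<psi> [(x, True)]"
        using psi.hom_inv x by metis
      then show ?thesis using psi x by (simp add: val_def)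
    qed
    show ?thesis using w
    proof (induction w)
      case Nil
      then show ?case using psi.hom_one by (simp add: free_group_def)
    next
      case (Cons l w)
      then have w: "w \<in> carrier (free_group S)" and l: "[l] \<in> carrier (free_group S)"
        and "fst l \<in> S"
        by (auto simp: free_group_def reduced_Cons)
      have "l # w = [l] \<otimes>\<^bsub>free_group S\<^esub> w"
        using Cons.prems by (cases w) (auto simp: free_group_def reduced_Cons)
      then have "\<psi> (l # w) = \<psi> [l] \<otimes>\<^bsub>H\<^esub> \<psi> w"
        using psi.hom_mult[OF l w] by simp
      then show ?case using Cons.IH w letter[OF \<open>fst l \<in> S\<close>] by simp
    qed
  qed
  show ?thesis using hom gen uniq by blast
qed


section \<open>One-relator groups\<close>

definition commutator :: "('a, 'b) monoid_scheme \<Rightarrow> 'a \<Rightarrow> 'a \<Rightarrow> 'a" where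
  "commutator G x y = inv\<^bsub>G\<^esub> x \<otimes>\<^bsub>G\<^esub> inv\<^bsub>G\<^esub> y \<otimes>\<^bsub>G\<^esub> x \<otimes>\<^bsub>G\<^esub> y"

definition normal_closure :: "('a, 'b) monoid_scheme \<Rightarrow> 'a \<Rightarrow> 'a set" where
  "normal_closure G r = \<Inter>{N. N \<lhd> G \<and> r \<in> N}"

definition one_relator_group :: "'a set \<Rightarrow> 'a letter list \<Rightarrow> 'a letter list set monoid" where
  "one_relator_group S r = free_group S Mod normal_closure (free_group S) r"

lemma (in group) normal_closure_normal:
  assumes "r \<in> carrier G"
  shows "normal_closure G r \<lhd> G"
proof -
  let ?A = "{N. N \<lhd> G \<and> r \<in> N}"
  have "carrier G \<lhd> G"
    by (simp add: normal_inv_iff subgroup_self)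
  with assms have ne: "?A \<noteq> {}" by auto
  have "subgroup (\<Inter>?A) G"
    using ne by (intro subgroups_Inter) (auto simp: normal_imp_subgroup)
  then show ?thesis
    unfolding normal_closure_def by (auto simp: normal_inv_iff)
qed

lemma group_one_relator_group:
  assumes "r \<in> carrier (free_group S)"
  shows "group (one_relator_group S r)"
  unfolding one_relator_group_def
  by (intro normal.factorgroup_is_group group.normal_closure_normal group_free_group assms)


section \<open>Hopfian and residually finite groups\<close>

definition hopfian :: "('a, 'b) monoid_scheme \<Rightarrow> bool" where
  "hopfian G \<longleftrightarrow> (\<forall>f\<in>epi G G. inj_on f (carrier G))"

definition residually_finite :: "('a, 'b) monoid_scheme \<Rightarrow> bool" where
  "residually_finite G \<longleftrightarrow> \<Inter>{N. N \<lhd> G \<and> finite (carrier (G Mod N))} = {\<one>\<^bsub>G\<^esub>}"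


section \<open>Automatic groups\<close>

record ('q, 's) automaton =
  states :: "'q set"
  start :: 'q
  trans :: "'q \<Rightarrow> 's \<Rightarrow> 'q"
  accepting :: "'q set"

definition finite_automaton :: "'s set \<Rightarrow> ('q, 's) automaton \<Rightarrow> bool" where
  "finite_automaton S M \<longleftrightarrow> finite (states M) \<and> start M \<in> states M \<and>
     (\<forall>q\<in>states M. \<forall>s\<in>S. trans M q s \<in> states M) \<and> accepting M \<subseteq> states M"

definition accepts :: "('q, 's) automaton \<Rightarrow> 's list \<Rightarrow> bool" where
  "accepts M w \<longleftrightarrow> foldl (trans M) (start M) w \<in> accepting M"

text \<open>
  A pair of words is read as a single word over pairs of padded letters, where \<open>None\<close> is the
  end-of-string symbol. The pair of two end-of-string symbols never occurs.
\<close>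

fun pad_pair :: "'a list \<Rightarrow> 'a list \<Rightarrow> ('a option \<times> 'a option) list" where
  "pad_pair [] [] = []"
| "pad_pair (a # v) [] = (Some a, None) # pad_pair v []"
| "pad_pair [] (b # w) = (None, Some b) # pad_pair [] w"
| "pad_pair (a # v) (b # w) = (Some a, Some b) # pad_pair v w"

definition pair_alphabet :: "'a set \<Rightarrow> ('a option \<times> 'a option) set" where
  "pair_alphabet A =
     (insert None (Some ` A) \<times> insert None (Some ` A)) - {(None, None)}"

definition lang :: "'a set \<Rightarrow> ('q, 'a) automaton \<Rightarrow> 'a list set" where
  "lang A W = {w \<in> lists A. accepts W w}"

definition pair_lang ::
    "'a set \<Rightarrow> ('q, 'a option \<times> 'a option) automaton \<Rightarrow> ('a list \<times> 'a list) set" where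
  "pair_lang A M = {(v, w). v \<in> lists A \<and> w \<in> lists A \<and> accepts M (pad_pair v w)}"

definition word_value :: "('g, 'b) monoid_scheme \<Rightarrow> ('a \<Rightarrow> 'g) \<Rightarrow> 'a list \<Rightarrow> 'g" where
  "word_value G p w = foldr (\<lambda>a g. p a \<otimes>\<^bsub>G\<^esub> g) w \<one>\<^bsub>G\<^esub>"

definition semigroup_generators :: "('g, 'b) monoid_scheme \<Rightarrow> 'a set \<Rightarrow> ('a \<Rightarrow> 'g) \<Rightarrow> bool" where
  "semigroup_generators G A p \<longleftrightarrow> p ` A \<subseteq> carrier G \<and>
     (\<forall>g\<in>carrier G. \<exists>w\<in>lists A. w \<noteq> [] \<and> word_value G p w = g)"

text \<open>
  The comparison automata are indexed by words of length at most one, so that the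
  index \<open>[]\<close> is the null string and \<open>[a]\<close> is the letter \<open>a\<close>.
\<close>

definition automatic_structure ::
    "('g, 'b) monoid_scheme \<Rightarrow> 'a set \<Rightarrow> ('a \<Rightarrow> 'g) \<Rightarrow> ('q, 'a) automaton \<Rightarrow>
      ('a list \<Rightarrow> ('q, 'a option \<times> 'a option) automaton) \<Rightarrow> bool" where
  "automatic_structure G A p W M \<longleftrightarrow>
     finite A \<and> semigroup_generators G A p \<and> finite_automaton A W \<and>
     word_value G p ` lang A W = carrier G \<and>
     (\<forall>x \<in> insert [] ((\<lambda>a. [a]) ` A).
        finite_automaton (pair_alphabet A) (M x) \<and>
        (\<forall>w1 w2. (w1, w2) \<in> pair_lang A (M x) \<longleftrightarrow>
           w1 \<in> lang A W \<and> w2 \<in> lang A W \<and>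
           word_value G p (w1 @ x) = word_value G p w2))"

text \<open>
  Alphabets and state sets are finite, so up to renaming they are sets of natural numbers.
\<close>

definition automatic :: "('g, 'b) monoid_scheme \<Rightarrow> bool" where
  "automatic G \<longleftrightarrow>
     (\<exists>(A :: nat set) p (W :: (nat, nat) automaton) M. automatic_structure G A p W M)"

end

theory Submission
  imports Defs "HOL-Real_Asymp.Real_Asymp"
begin

text \<open>
  Let \<open>g = [z, y]\<close> and \<open>r = [y g\<^sup>m, z]\<close>. The relation \<open>r = 1\<close> says that \<open>z\<^sup>-\<^sup>1 g\<^sup>m z = g\<^sup>m\<^sup>+\<^sup>1\<close>, so the one-relator group
  is the amalgam of the Baumslag--Solitar group \<open>BS(m, m + 1)\<close> and \<open>\<int>\<^sup>2\<close> along \<open>\<langle>z\<rangle>\<close>.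

  For \<open>m = 2\<close>, the assignment \<open>y \<mapsto> y g\<^sup>-\<^sup>2\<close>, \<open>z \<mapsto> z\<close> induces a surjective endomorphism with \<open>g \<mapsto> g\<^sup>2\<close>. It
  kills \<open>[g, z\<^sup>-\<^sup>1 g z]\<close>, which is nontrivial, as a permutation action shows, and which dies in all finite
  quotients.

  For \<open>m = 1\<close>, the word \<open>[g, z\<^sup>-\<^sup>n g z\<^sup>n]\<close> is trivial in the group and has length \<open>4 n + 4\<close> in
  \<open>g\<close> and \<open>z\<close>, but its area is at least \<open>2\<^sup>n - 1\<close>: the free group acts on a bundle of lines so that the
  relator displaces points in their fibre by at most 1, and this word displaces some point by
  \<open>2\<^sup>n - 1\<close>. In an automatic group, areas are bounded by a quadratic function of the length.
\<close>

section \<open>Filling in automatic groups\<close>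

text \<open>Padding sits at the end only, so reading letter by letter respects concatenation as long
  as the word that runs out first is followed by nothing.\<close>

lemma pad_pair_append:
  assumes "length v = length w \<or> length v \<le> length w \<and> v' = [] \<or> length w \<le> length v \<and> w' = []"
  shows "pad_pair (v @ v') (w @ w') = pad_pair v w @ pad_pair v' w'"
  using assms
proof (induction v w rule: pad_pair.induct)
  case (2 a v)
  then show ?case by (cases v') auto
next
  case (3 b w)
  then show ?case by (cases w') auto
qed auto

lemma set_pad_pair:
  assumes "v \<in> lists A" "w \<in> lists A"
  shows "set (pad_pair v w) \<subseteq> pair_alphabet A"
  using assms by (induction v w rule: pad_pair.induct) (auto simp: pair_alphabet_def)

lemma foldl_trans_states:
  assumes "finite_automaton S M" "set w \<subseteq> S"
  shows "foldl (trans M) (start M) w \<in> states M"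
  using assms(2)
proof (induction w rule: rev_induct)
  case Nil
  then show ?case using assms(1) by (simp add: finite_automaton_def)
next
  case (snoc s w)
  then show ?case using assms(1) by (simp add: finite_automaton_def)
qed

context group
begin

lemma inv_cancel_left [simp]:
  assumes "x \<in> carrier G" "y \<in> carrier G"
  shows "inv x \<otimes> (x \<otimes> y) = y" "x \<otimes> (inv x \<otimes> y) = y"
  using assms by (simp_all flip: m_assoc)

lemma word_value_Nil [simp]: "word_value G p [] = \<one>"
  by (simp add: word_value_def)

lemma word_value_Cons [simp]: "word_value G p (a # w) = p a \<otimes> word_value G p w"
  by (simp add: word_value_def)

lemma word_value_closed [intro, simp]:
  assumes "p ` A \<subseteq> carrier G" "w \<in> lists A"
  shows "word_value G p w \<in> carrier G"
  using assms(2,1) by induction auto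

lemma word_value_append:
  assumes "p ` A \<subseteq> carrier G" "v \<in> lists A" "w \<in> lists A"
  shows "word_value G p (v @ w) = word_value G p v \<otimes> word_value G p w"
  using assms(2)
proof induction
  case (Cons a v)
  have "p a \<in> carrier G" using Cons assms(1) by auto
  then show ?case using Cons assms word_value_closed[OF assms(1)] by (simp add: m_assoc)
qed (use assms in simp)

end

text \<open>Meant for \<open>k\<close> the configuration of an automaton and \<open>d\<close> the
  word difference: what is determined by finitely many configurations takes finitely many
  values.\<close>

lemma finite_image_if_factors:
  assumes "finite (k ` T)" "\<And>x y. x \<in> T \<Longrightarrow> y \<in> T \<Longrightarrow> k x = k y \<Longrightarrow> d x = d y"
  shows "finite (d ` T)"
proof -
  have "d ` T \<subseteq> (\<lambda>q. d (inv_into T k q)) ` k ` T"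
  proof safe
    fix x assume "x \<in> T"
    then have "d x = d (inv_into T k (k x))"
      by (metis assms(2) f_inv_into_f imageI inv_into_into)
    then show "d x \<in> (\<lambda>q. d (inv_into T k q)) ` k ` T" using \<open>x \<in> T\<close> by blast
  qed
  then show ?thesis using assms(1) finite_surj by blast
qed

section \<open>Word differences in an automatic group\<close>

locale automatic_group = group G for G (structure) +
  fixes A :: "'s set" and p :: "'s \<Rightarrow> 'a" and W :: "('q, 's) automaton"
    and M :: "'s list \<Rightarrow> ('q, 's option \<times> 's option) automaton"
  assumes automatic: "automatic_structure G A p W M"
begin

lemma finite_alphabet: "finite A"
  and generators: "p ` A \<subseteq> carrier G"
  and lang_surj: "word_value G p ` lang A W = carrier G"
  and semigroup_generated: "g \<in> carrier G \<Longrightarrow> \<exists>w\<in>lists A. w \<noteq> [] \<and> word_value G p w = g"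
  using automatic by (auto simp: automatic_structure_def semigroup_generators_def)

lemma lang_lists: "w \<in> lang A W \<Longrightarrow> w \<in> lists A"
  by (simp add: lang_def)

lemma comparison_automaton:
  assumes "a \<in> A"
  shows "finite_automaton (pair_alphabet A) (M [a])"
    and "(v, w) \<in> pair_lang A (M [a]) \<longleftrightarrow> v \<in> lang A W \<and> w \<in> lang A W \<and>
      word_value G p (v @ [a]) = word_value G p w"
  using automatic assms unfolding automatic_structure_def by blast+

text \<open>These are the labelled edges of the Cayley graph, with accepted words for both
  endpoints.\<close>

definition neighbours :: "('s \<times> 's list \<times> 's list) set" where
  "neighbours = {(a, v, w). a \<in> A \<and> v \<in> lang A W \<and> w \<in> lang A W \<and>
     word_value G p (v @ [a]) = word_value G p w}"

text \<open>
  Besides the state, a configuration records which of the words are exhausted: only an exhausted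
  word may be continued by an exhausted one, because padding occurs at the end only.
\<close>

fun config where
  "config ((a, v, w), t) =
     (a, foldl (trans (M [a])) (start (M [a])) (pad_pair (take t v) (take t w)),
      drop t v = [], drop t w = [])"

lemma take_lists: "w \<in> lists A \<Longrightarrow> take t w \<in> lists A"
  by (auto dest: in_set_takeD)

lemma drop_lists: "w \<in> lists A \<Longrightarrow> drop t w \<in> lists A"
  by (auto dest: in_set_dropD)

lemma finite_configs: "finite (config ` (neighbours \<times> UNIV))"
proof -
  have "finite ((\<lambda>((a, q), b). (a, q, b)) `
      ((SIGMA a:A. states (M [a])) \<times> (UNIV :: (bool \<times> bool) set)))" (is "finite ?C")
    using comparison_automaton(1) finite_alphabet
    by (intro finite_imageI finite_cartesian_product finite_SigmaI) (auto simp: finite_automaton_def)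
  moreover have "config x \<in> ?C" if "x \<in> neighbours \<times> UNIV" for x
  proof -
    obtain a v w t where x: "x = ((a, v, w), t)" by (metis surj_pair)
    with that have n: "(a, v, w) \<in> neighbours" by simp
    have a: "a \<in> A" using n by (simp add: neighbours_def)
    have "set (pad_pair (take t v) (take t w)) \<subseteq> pair_alphabet A"
      using n by (intro set_pad_pair take_lists lang_lists) (auto simp: neighbours_def)
    then have "foldl (trans (M [a])) (start (M [a])) (pad_pair (take t v) (take t w)) \<in> states (M [a])"
      using foldl_trans_states comparison_automaton(1) a by blast
    then show ?thesis unfolding x
      using a by (intro image_eqI[where x = "((_, _), (_, _))"]) auto
  qed
  then have "config ` (neighbours \<times> UNIV) \<subseteq> ?C" by (rule image_subsetI)
  ultimately show ?thesis using finite_subset by blast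
qed

lemma neighbours_iff:
  "(a, v, w) \<in> neighbours \<longleftrightarrow>
     a \<in> A \<and> v \<in> lists A \<and> w \<in> lists A \<and> accepts (M [a]) (pad_pair v w)"
proof (cases "a \<in> A")
  case True
  then show ?thesis
    using comparison_automaton(2)[OF True, of v w]
    unfolding neighbours_def pair_lang_def by auto
qed (auto simp: neighbours_def)

text \<open>Cut and paste: two runs that have reached the same state can swap their remainders. The
  exhaustion flags ensure that the spliced words are still padded at their ends only.\<close>

lemma exchange:
  assumes "(a, v, w) \<in> neighbours" "(a', v', w') \<in> neighbours"
    and eq: "config ((a, v, w), t) = config ((a', v', w'), s)"
  shows "(a, take t v @ drop s v', take t w @ drop s w') \<in> neighbours"
proof -
  from eq have [simp]: "a' = a" by simp
  have app: "pad_pair (take r x @ y) (take r z @ u) = pad_pair (take r x) (take r z) @ pad_pair y u"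
    if "drop r x = [] \<longleftrightarrow> y = []" "drop r z = [] \<longleftrightarrow> u = []" for r and x y z u :: "'s list"
    using that by (intro pad_pair_append) (auto simp: min_def)
  have "accepts (M [a]) (pad_pair (take s v' @ drop s v') (take s w' @ drop s w'))"
    using assms(2) by (simp add: neighbours_iff)
  then have "accepts (M [a]) (pad_pair (take t v @ drop s v') (take t w @ drop s w'))"
    using eq unfolding accepts_def by (subst (asm) app, simp, simp, subst app) auto
  moreover have "take t v @ drop s v' \<in> lists A" "take t w @ drop s w' \<in> lists A"
    using assms take_lists drop_lists unfolding neighbours_iff append_in_lists_conv by blast+
  ultimately show ?thesis using assms unfolding neighbours_iff by simp
qed

text \<open>That only finitely many of these word differences occur is the fellow traveller
  property.\<close>

fun difference where
  "difference ((a, v, w), t) = inv (word_value G p (take t v)) \<otimes> word_value G p (take t w)"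

text \<open>The difference at time \<open>t\<close> can be read off from any continuations
  \<open>v'\<close>, \<open>w'\<close> to a pair of neighbours, as \<open>v' a w'^-1\<close>. By
  \<open>exchange\<close>, equal configurations admit equal continuations.\<close>

lemma finite_differences: "finite (difference ` (neighbours \<times> UNIV))"
proof (rule finite_image_if_factors[OF finite_configs])
  note [simp] = word_value_closed[OF generators] and [intro, simp] = take_lists drop_lists lang_lists
  have diff: "difference ((a, v, w), t) = word_value G p v' \<otimes> p a \<otimes> inv (word_value G p w')"
    if "(a, take t v @ v', take t w @ w') \<in> neighbours" for a v w t v' w'
  proof -
    let ?v = "word_value G p (take t v)" and ?w = "word_value G p (take t w)"
    let ?v' = "word_value G p v'" and ?w' = "word_value G p w'"
    have l: "take t v \<in> lists A" "v' \<in> lists A" "take t w \<in> lists A" "w' \<in> lists A" and a: "a \<in> A"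
      using that unfolding neighbours_iff append_in_lists_conv by auto
    then have c: "?v \<in> carrier G" "?w \<in> carrier G" "?v' \<in> carrier G" "?w' \<in> carrier G"
        "p a \<in> carrier G"
      using generators by auto
    have "word_value G p ((take t v @ v') @ [a]) = word_value G p (take t w @ w')"
      using that unfolding neighbours_def by simp
    then have "?v \<otimes> (?v' \<otimes> p a) = ?w \<otimes> ?w'"
      using l a c by (simp add: word_value_append[OF generators] m_assoc)
    then have "?v' \<otimes> p a = inv ?v \<otimes> ?w \<otimes> ?w'"
      using c by (metis inv_cancel_left(1) inv_closed m_assoc m_closed)
    then show ?thesis using c by (simp add: m_assoc)
  qed
  fix x y assume "x \<in> neighbours \<times> UNIV" "y \<in> neighbours \<times> UNIV" and eq: "config x = config y"
  moreover obtain a v w t where x: "x = ((a, v, w), t)" by (metis surj_pair)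
  moreover obtain a' v' w' s where y: "y = ((a', v', w'), s)" by (metis surj_pair)
  ultimately have xy: "(a, v, w) \<in> neighbours" "(a', v', w') \<in> neighbours"
      "config ((a, v, w), t) = config ((a', v', w'), s)"
    by blast+
  then have [simp]: "a' = a" by simp
  have "difference x = word_value G p (drop s v') \<otimes> p a \<otimes> inv (word_value G p (drop s w'))"
    unfolding x by (rule diff[OF exchange[OF xy]])
  moreover have "difference y = word_value G p (drop s v') \<otimes> p a \<otimes> inv (word_value G p (drop s w'))"
    unfolding y by (subst diff) (use xy(2) in simp_all)
  ultimately show "difference x = difference y" by simp
qed

text \<open>Once \<open>v\<close> has been read, the rest of \<open>w\<close> can be replaced by the
  rest belonging to a fixed representative of the same configuration. There are finitely many
  configurations, so these rests have bounded length.\<close>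

lemma neighbour_length_bound:
  obtains c where "\<And>a v. a \<in> A \<Longrightarrow> v \<in> lang A W \<Longrightarrow>
    \<exists>w\<in>lang A W. word_value G p (v @ [a]) = word_value G p w \<and> length w \<le> length v + c"
proof -
  let ?T = "neighbours \<times> (UNIV :: nat set)"
  let ?rest = "\<lambda>((a, v, w), t). length (drop t w)"
  define c where "c = Max ((\<lambda>q. ?rest (inv_into ?T config q)) ` config ` ?T)"
  have "\<exists>w\<in>lang A W. word_value G p (v @ [a]) = word_value G p w \<and> length w \<le> length v + c"
    if a: "a \<in> A" and v: "v \<in> lang A W" for a v
  proof -
    have "v @ [a] \<in> lists A" using a v by (auto simp: lang_def)
    then have "word_value G p (v @ [a]) \<in> carrier G" using generators by blast
    then obtain w where "w \<in> lang A W" "word_value G p (v @ [a]) = word_value G p w"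
      using lang_surj by (metis imageE)
    then have n: "(a, v, w) \<in> neighbours" using a v by (simp add: neighbours_def)
    let ?x = "((a, v, w), length v)"
    have "?x \<in> ?T" using n by simp
    then have y: "inv_into ?T config (config ?x) \<in> ?T"
        "config (inv_into ?T config (config ?x)) = config ?x"
      by (simp_all only: imageI inv_into_into f_inv_into_f)
    obtain a' v' w' s where y': "inv_into ?T config (config ?x) = ((a', v', w'), s)"
      by (metis surj_pair)
    have "(a, take (length v) v @ drop s v', take (length v) w @ drop s w') \<in> neighbours"
      by (rule exchange[OF n]) (use y in \<open>unfold y', blast, metis\<close>)
    \<comment> \<open>The exhaustion flag of \<open>v\<close> is set at time
      \<open>length v\<close>, hence also in the representative; the splice leaves \<open>v\<close>
      as it is.\<close>
    moreover have "drop s v' = []" using y(2) unfolding y' by simp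
    ultimately have n': "(a, v, take (length v) w @ drop s w') \<in> neighbours" by simp
    have "?rest (inv_into ?T config (config ?x)) \<le> c"
      unfolding c_def using finite_configs \<open>?x \<in> ?T\<close> by (intro Max_ge) blast+
    then have "length (drop s w') \<le> c" unfolding y' by simp
    then show ?thesis using n' unfolding neighbours_def
      by (intro bexI[of _ "take (length v) w @ drop s w'"]) auto
  qed
  then show thesis using that by blast
qed

text \<open>A shortest accepted word is chosen so that it inherits the bound of
  \<open>neighbour_length_bound\<close>, which concerns just some accepted word.\<close>

definition rep :: "'a \<Rightarrow> 's list" where
  "rep g = arg_min length (\<lambda>w. w \<in> lang A W \<and> word_value G p w = g)"

lemma rep:
  assumes "g \<in> carrier G"
  shows rep_lang: "rep g \<in> lang A W" and word_value_rep: "word_value G p (rep g) = g"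
    and length_rep_le: "\<And>w. w \<in> lang A W \<Longrightarrow> word_value G p w = g \<Longrightarrow> length (rep g) \<le> length w"
proof -
  obtain w where w: "w \<in> lang A W \<and> word_value G p w = g" using assms lang_surj by (metis imageE)
  show "rep g \<in> lang A W" "word_value G p (rep g) = g"
    using arg_min_natI[of "\<lambda>w. w \<in> lang A W \<and> word_value G p w = g", OF w] unfolding rep_def by auto
  show "\<And>w. w \<in> lang A W \<Longrightarrow> word_value G p w = g \<Longrightarrow> length (rep g) \<le> length w"
    using arg_min_nat_le[of "\<lambda>w. w \<in> lang A W \<and> word_value G p w = g"] unfolding rep_def by auto
qed

lemma rep_neighbour:
  assumes "g \<in> carrier G" "a \<in> A"
  shows "(a, rep g, rep (g \<otimes> p a)) \<in> neighbours"
proof -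
  have "p a \<in> carrier G" using assms generators by blast
  then show ?thesis
    using assms rep[of g] rep[of "g \<otimes> p a"] lang_lists generators
    by (auto simp: neighbours_def word_value_append[OF generators])
qed

lemma length_rep_mult:
  obtains c where "\<And>g a. g \<in> carrier G \<Longrightarrow> a \<in> A \<Longrightarrow> length (rep (g \<otimes> p a)) \<le> length (rep g) + c"
proof -
  obtain c where c: "\<And>a v. a \<in> A \<Longrightarrow> v \<in> lang A W \<Longrightarrow>
    \<exists>w\<in>lang A W. word_value G p (v @ [a]) = word_value G p w \<and> length w \<le> length v + c"
    using neighbour_length_bound by blast
  have "length (rep (g \<otimes> p a)) \<le> length (rep g) + c" if g: "g \<in> carrier G" and a: "a \<in> A" for g a
  proof -
    have pa: "p a \<in> carrier G" using a generators by blast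
    obtain w where w: "w \<in> lang A W" "word_value G p (rep g @ [a]) = word_value G p w"
        "length w \<le> length (rep g) + c"
      using c[OF a rep_lang[OF g]] by blast
    have "word_value G p (rep g @ [a]) = g \<otimes> p a"
      using g a pa rep[OF g] lang_lists by (simp add: word_value_append[OF generators])
    then have "length (rep (g \<otimes> p a)) \<le> length w" using w g pa by (intro length_rep_le) auto
    then show ?thesis using w(3) by simp
  qed
  then show thesis using that by blast
qed

end

text \<open>
  An abstract filling function: \<open>B n\<close> plays the role of the set of elements of the kernel of
  \<open>\<pi>\<close> of area at most \<open>n\<close>.
\<close>

locale automatic_filling = automatic_group G A p W M + F: group F
  for F :: "('f, 'c) monoid_scheme" and G :: "('a, 'b) monoid_scheme" (structure)
    and A :: "'s set" and p and W :: "('q, 's) automaton" and M +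
  fixes \<pi> :: "'f \<Rightarrow> 'a" and B :: "nat \<Rightarrow> 'f set"
  assumes hom: "\<pi> \<in> hom F G"
    and surj: "\<pi> ` carrier F = carrier G"
    and B_mono: "m \<le> n \<Longrightarrow> B m \<subseteq> B n"
    and B_mult: "u \<in> B m \<Longrightarrow> v \<in> B n \<Longrightarrow> u \<otimes>\<^bsub>F\<^esub> v \<in> B (m + n)"
    and B_conj: "u \<in> B m \<Longrightarrow> f \<in> carrier F \<Longrightarrow> f \<otimes>\<^bsub>F\<^esub> u \<otimes>\<^bsub>F\<^esub> inv\<^bsub>F\<^esub> f \<in> B m"
    and B_kernel: "u \<in> kernel F G \<pi> \<Longrightarrow> \<exists>m. u \<in> B m"
begin

sublocale pi: group_hom F G \<pi>
  by unfold_locales (rule hom)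

section \<open>Areas of strips and of words in the kernel\<close>

definition lift :: "'a \<Rightarrow> 'f" where
  "lift = inv_into (carrier F) \<pi>"

definition val :: "'s list \<Rightarrow> 'f" where
  "val = word_value F (\<lambda>a. lift (p a))"

lemma lift [simp]: "g \<in> carrier G \<Longrightarrow> lift g \<in> carrier F" "g \<in> carrier G \<Longrightarrow> \<pi> (lift g) = g"
  unfolding lift_def using surj by (metis inv_into_into) (metis f_inv_into_f surj)

lemma generator_closed [simp]: "a \<in> A \<Longrightarrow> p a \<in> carrier G"
  using generators by blast

lemma lift_generators: "(\<lambda>a. lift (p a)) ` A \<subseteq> carrier F"
  by auto

lemma val_closed [simp]: "w \<in> lists A \<Longrightarrow> val w \<in> carrier F"
  unfolding val_def using lift_generators by blast

lemma val_snoc: "w \<in> lists A \<Longrightarrow> a \<in> A \<Longrightarrow> val (w @ [a]) = val w \<otimes>\<^bsub>F\<^esub> lift (p a)"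
  unfolding val_def by (simp add: F.word_value_append[OF lift_generators])

lemma pi_val [simp]: "w \<in> lists A \<Longrightarrow> \<pi> (val w) = word_value G p w"
proof (induction rule: lists.induct)
  case (Cons a w)
  then have "val (a # w) = lift (p a) \<otimes>\<^bsub>F\<^esub> val w" by (simp add: val_def)
  then show ?case using Cons by (simp only: pi.hom_mult) simp
qed (simp add: val_def)

lemma finite_subset_kernel_bound:
  assumes "finite Y" "Y \<subseteq> kernel F G \<pi>"
  shows "\<exists>C. Y \<subseteq> B C"
  using assms
proof induction
  case (insert x Y)
  then obtain C m where "Y \<subseteq> B C" "x \<in> B m" using B_kernel by blast
  then have "insert x Y \<subseteq> B (max C m)"
    using B_mono[of C "max C m"] B_mono[of m "max C m"] by auto
  then show ?case ..
qed simp

text \<open>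
  The strip between two neighbouring words of the language is cut into cells, one for each step
  of the comparison automaton. Only finitely many shapes of cells occur.
\<close>

lemma strip_bound:
  obtains C where "\<And>a v w. (a, v, w) \<in> neighbours \<Longrightarrow>
    val v \<otimes>\<^bsub>F\<^esub> lift (p a) \<otimes>\<^bsub>F\<^esub> inv\<^bsub>F\<^esub> val w \<in> B (C * (max (length v) (length w) + 1))"
proof -
  define D where "D = difference ` (neighbours \<times> UNIV)"
  \<comment> \<open>The element \<open>\<one>\<close> is the step of a word that has already ended,
    as the two words may differ in length.\<close>
  define Q where "Q = insert \<one>\<^bsub>F\<^esub> ((\<lambda>a. lift (p a)) ` A)"
  \<comment> \<open>The boundary of a cell: along \<open>x\<close>, across by the new difference,
    back along \<open>y\<close>, back across by the old difference.\<close>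
  define cell where "cell = (\<lambda>(x, y, d, d'). x \<otimes>\<^bsub>F\<^esub> lift d' \<otimes>\<^bsub>F\<^esub> inv\<^bsub>F\<^esub> y \<otimes>\<^bsub>F\<^esub> inv\<^bsub>F\<^esub> lift d)"
  have Q: "finite Q" "Q \<subseteq> carrier F" using finite_alphabet by (auto simp: Q_def)
  \<comment> \<open>The section \<open>lift\<close> is arbitrary, so \<open>lift \<one>\<close> may
    differ from the identity of \<open>F\<close>; it lies in the kernel and opens the strip at time
    0.\<close>
  have "finite (insert (lift \<one>) (cell ` (Q \<times> Q \<times> D \<times> D)) \<inter> kernel F G \<pi>)"
    using Q finite_differences unfolding D_def by blast
  then obtain C where C: "insert (lift \<one>) (cell ` (Q \<times> Q \<times> D \<times> D)) \<inter> kernel F G \<pi> \<subseteq> B C"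
    using finite_subset_kernel_bound by blast
  have step: "\<exists>x\<in>Q. val (take (Suc t) v) = val (take t v) \<otimes>\<^bsub>F\<^esub> x" if v: "v \<in> lists A" for t v
  proof (cases "t < length v")
    case True
    then have "v ! t \<in> A" using v by (simp add: in_lists_conv_set)
    then show ?thesis
      using True val_snoc[OF take_lists[OF v]] by (auto simp: take_Suc_conv_app_nth Q_def)
  next
    case False
    then show ?thesis using v by (auto simp: Q_def)
  qed
  have "val v \<otimes>\<^bsub>F\<^esub> lift (p a) \<otimes>\<^bsub>F\<^esub> inv\<^bsub>F\<^esub> val w \<in> B (C * (max (length v) (length w) + 1))"
    if n: "(a, v, w) \<in> neighbours" for a v w
  proof -
    have a: "a \<in> A" and vw: "v \<in> lists A" "w \<in> lists A" using n by (auto simp: neighbours_iff)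
    let ?d = "\<lambda>t. inv (word_value G p (take t v)) \<otimes> word_value G p (take t w)"
    have D: "?d t \<in> D" for t
      unfolding D_def using n by (intro image_eqI[where x = "((a, v, w), t)"]) auto
    \<comment> \<open>The strip is cut off at time \<open>t\<close> and closed by the lifted
      difference. It consists of \<open>t\<close> cells and the initial \<open>lift \<one>\<close>,
      each in \<open>B C\<close>.\<close>
    have "val (take t v) \<otimes>\<^bsub>F\<^esub> lift (?d t) \<otimes>\<^bsub>F\<^esub> inv\<^bsub>F\<^esub> val (take t w) \<in> B (C * (t + 1))" for t
    proof (induction t)
      case 0
      have "lift \<one> \<in> kernel F G \<pi>" by (simp add: kernel_def)
      then have "lift \<one> \<in> B C" using C by blast
      then show ?case by (simp add: val_def)
    next
      case (Suc t)
      let ?v = "val (take t v)" and ?w = "val (take t w)"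
      obtain x y where xy: "x \<in> Q" "y \<in> Q" "val (take (Suc t) v) = ?v \<otimes>\<^bsub>F\<^esub> x"
          "val (take (Suc t) w) = ?w \<otimes>\<^bsub>F\<^esub> y"
        using step vw by blast
      have xyF: "x \<in> carrier F" "y \<in> carrier F" using xy Q by auto
      have tF: "take s v \<in> lists A" "take s w \<in> lists A" for s using vw take_lists by blast+
      have cF: "?v \<in> carrier F" "?w \<in> carrier F" using tF by auto
      have wv: "word_value G p (take s v) \<in> carrier G" "word_value G p (take s w) \<in> carrier G" for s
        using tF generators by auto
      then have dG: "?d s \<in> carrier G" for s by simp
      have dS: "?d (Suc t) = inv (\<pi> (?v \<otimes>\<^bsub>F\<^esub> x)) \<otimes> \<pi> (?w \<otimes>\<^bsub>F\<^esub> y)"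
        unfolding xy(3,4)[symmetric] using tF by simp
      have "\<pi> (cell (x, y, ?d t, ?d (Suc t))) = \<pi> x \<otimes> ?d (Suc t) \<otimes> inv (\<pi> y) \<otimes> inv (?d t)"
        using xyF dG by (simp add: cell_def)
      moreover have "\<pi> x \<otimes> ?d (Suc t) \<otimes> inv (\<pi> y) \<otimes> inv (?d t) = \<one>"
        unfolding dS using xyF cF tF wv by (simp add: inv_mult_group m_assoc)
      moreover have "cell (x, y, ?d t, ?d (Suc t)) \<in> carrier F"
        using xyF dG by (simp add: cell_def)
      ultimately have "cell (x, y, ?d t, ?d (Suc t)) \<in> kernel F G \<pi>"
        by (simp only: kernel_def mem_Collect_eq)
      then have cell: "cell (x, y, ?d t, ?d (Suc t)) \<in> B C"
        using C xy(1,2) D by blast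
      have "(?v \<otimes>\<^bsub>F\<^esub> x) \<otimes>\<^bsub>F\<^esub> lift (?d (Suc t)) \<otimes>\<^bsub>F\<^esub> inv\<^bsub>F\<^esub> (?w \<otimes>\<^bsub>F\<^esub> y) =
        (?v \<otimes>\<^bsub>F\<^esub> cell (x, y, ?d t, ?d (Suc t)) \<otimes>\<^bsub>F\<^esub> inv\<^bsub>F\<^esub> ?v) \<otimes>\<^bsub>F\<^esub>
        (?v \<otimes>\<^bsub>F\<^esub> lift (?d t) \<otimes>\<^bsub>F\<^esub> inv\<^bsub>F\<^esub> ?w)"
        using xyF cF lift(1)[OF dG[of t]] lift(1)[OF dG[of "Suc t"]]
        by (simp add: cell_def F.inv_mult_group F.m_assoc)
      also have "\<dots> \<in> B (C + C * (t + 1))"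
        by (rule B_mult[OF B_conj[OF cell cF(1)] Suc.IH])
      finally show ?case unfolding xy(3,4) by simp
    qed
    \<comment> \<open>By this time both words have ended and the difference is \<open>p a\<close>,
      so the closing side is \<open>lift (p a)\<close>.\<close>
    from this[of "max (length v) (length w)"]
    have "val v \<otimes>\<^bsub>F\<^esub> lift (inv (word_value G p v) \<otimes> word_value G p w) \<otimes>\<^bsub>F\<^esub> inv\<^bsub>F\<^esub> val w
      \<in> B (C * (max (length v) (length w) + 1))" by simp
    moreover have "word_value G p w = word_value G p v \<otimes> p a"
      using n a vw by (simp add: neighbours_def word_value_append[OF generators])
    then have "inv (word_value G p v) \<otimes> word_value G p w = p a"
      using a vw generators by (simp flip: m_assoc)
    ultimately show ?thesis by simp
  qed
  then show thesis using that by blast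
qed

text \<open>The length clause is there for products: it controls the representative at which the
  next strip begins. The other clause concerns the loop along \<open>rep g\<close>, then
  \<open>f\<close>, and back along the representative of the endpoint.\<close>

definition linearly_fillable :: "nat \<Rightarrow> 'f \<Rightarrow> bool" where
  "linearly_fillable C f \<longleftrightarrow> f \<in> carrier F \<and> (\<forall>g\<in>carrier G.
     length (rep (g \<otimes> \<pi> f)) \<le> length (rep g) + C \<and>
     val (rep g) \<otimes>\<^bsub>F\<^esub> f \<otimes>\<^bsub>F\<^esub> inv\<^bsub>F\<^esub> val (rep (g \<otimes> \<pi> f)) \<in> B (C * (length (rep g) + 1)))"

lemma linearly_fillable_mono:
  "linearly_fillable C f \<Longrightarrow> C \<le> C' \<Longrightarrow> linearly_fillable C' f"
  unfolding linearly_fillable_def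
  by (meson B_mono add_left_mono le_trans mult_le_mono1 subsetD)

lemma rep_lists [simp]: "g \<in> carrier G \<Longrightarrow> rep g \<in> lists A"
  using rep_lang lang_lists by blast

text \<open>The two strips are glued along \<open>rep (g \<otimes> \<pi> f)\<close>. The second one
  starts from a word longer than \<open>rep g\<close> by up to \<open>C\<close>, which accounts for
  the factor \<open>C + 1\<close>.\<close>

lemma linearly_fillable_mult:
  assumes f: "linearly_fillable C f" and f': "linearly_fillable C' f'"
  shows "linearly_fillable (C + C' * (C + 1)) (f \<otimes>\<^bsub>F\<^esub> f')"
  unfolding linearly_fillable_def
proof (intro conjI ballI)
  have F: "f \<in> carrier F" "f' \<in> carrier F" using assms by (auto simp: linearly_fillable_def)
  then show "f \<otimes>\<^bsub>F\<^esub> f' \<in> carrier F" by simp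
  fix g assume g: "g \<in> carrier G"
  let ?g' = "g \<otimes> \<pi> f"
  let ?l = "length (rep g)"
  have g': "?g' \<in> carrier G" "?g' \<otimes> \<pi> f' \<in> carrier G" using F g by auto
  have assoc: "g \<otimes> \<pi> (f \<otimes>\<^bsub>F\<^esub> f') = ?g' \<otimes> \<pi> f'" using F g by (simp add: m_assoc)
  have l: "length (rep ?g') \<le> ?l + C" "length (rep (?g' \<otimes> \<pi> f')) \<le> length (rep ?g') + C'"
    using f f' g g' by (auto simp: linearly_fillable_def)
  then show "length (rep (g \<otimes> \<pi> (f \<otimes>\<^bsub>F\<^esub> f'))) \<le> ?l + (C + C' * (C + 1))"
    unfolding assoc by (simp add: algebra_simps)
  have "(val (rep g) \<otimes>\<^bsub>F\<^esub> f \<otimes>\<^bsub>F\<^esub> inv\<^bsub>F\<^esub> val (rep ?g')) \<otimes>\<^bsub>F\<^esub>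
      (val (rep ?g') \<otimes>\<^bsub>F\<^esub> f' \<otimes>\<^bsub>F\<^esub> inv\<^bsub>F\<^esub> val (rep (?g' \<otimes> \<pi> f')))
      \<in> B (C * (?l + 1) + C' * (length (rep ?g') + 1))"
    using f f' g g' by (intro B_mult) (auto simp: linearly_fillable_def)
  also have "C' * (length (rep ?g') + 1) \<le> C' * ((C + 1) * (?l + 1))"
    using l(1) by (intro mult_le_mono2) (simp add: algebra_simps)
  then have "B (C * (?l + 1) + C' * (length (rep ?g') + 1)) \<subseteq> B ((C + C' * (C + 1)) * (?l + 1))"
    by (intro B_mono) (simp only: add_mult_distrib mult.assoc add_left_mono)
  also have "(val (rep g) \<otimes>\<^bsub>F\<^esub> f \<otimes>\<^bsub>F\<^esub> inv\<^bsub>F\<^esub> val (rep ?g')) \<otimes>\<^bsub>F\<^esub>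
      (val (rep ?g') \<otimes>\<^bsub>F\<^esub> f' \<otimes>\<^bsub>F\<^esub> inv\<^bsub>F\<^esub> val (rep (?g' \<otimes> \<pi> f'))) =
      val (rep g) \<otimes>\<^bsub>F\<^esub> (f \<otimes>\<^bsub>F\<^esub> f') \<otimes>\<^bsub>F\<^esub> inv\<^bsub>F\<^esub> val (rep (?g' \<otimes> \<pi> f'))"
    using F g g' by (simp add: F.m_assoc)
  finally show "val (rep g) \<otimes>\<^bsub>F\<^esub> (f \<otimes>\<^bsub>F\<^esub> f') \<otimes>\<^bsub>F\<^esub> inv\<^bsub>F\<^esub> val (rep (g \<otimes> \<pi> (f \<otimes>\<^bsub>F\<^esub> f')))
      \<in> B ((C + C' * (C + 1)) * (?l + 1))" unfolding assoc .
qed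

text \<open>Here \<open>g \<otimes> \<pi> f = g\<close>, so the loop is a conjugate of
  \<open>f\<close> and its area is bounded independently of \<open>g\<close>.\<close>

lemma linearly_fillable_kernel:
  assumes "f \<in> kernel F G \<pi>"
  shows "\<exists>C. linearly_fillable C f"
proof -
  obtain C where C: "f \<in> B C" using assms B_kernel by blast
  have f: "f \<in> carrier F" "\<pi> f = \<one>" using assms by (auto simp: kernel_def)
  have "linearly_fillable C f" unfolding linearly_fillable_def
  proof (intro conjI ballI)
    fix g assume g: "g \<in> carrier G"
    have "val (rep g) \<otimes>\<^bsub>F\<^esub> f \<otimes>\<^bsub>F\<^esub> inv\<^bsub>F\<^esub> val (rep g) \<in> B C"
      using C g by (intro B_conj) auto
    then show "val (rep g) \<otimes>\<^bsub>F\<^esub> f \<otimes>\<^bsub>F\<^esub> inv\<^bsub>F\<^esub> val (rep (g \<otimes> \<pi> f)) \<in> B (C * (length (rep g) + 1))"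
      using B_mono[of C "C * (length (rep g) + 1)"] f g by auto
  qed (use f in auto)
  then show ?thesis ..
qed

lemma linearly_fillable_generator:
  assumes a: "a \<in> A"
  shows "\<exists>C. linearly_fillable C (lift (p a))"
proof -
  obtain C where C: "\<And>a v w. (a, v, w) \<in> neighbours \<Longrightarrow>
    val v \<otimes>\<^bsub>F\<^esub> lift (p a) \<otimes>\<^bsub>F\<^esub> inv\<^bsub>F\<^esub> val w \<in> B (C * (max (length v) (length w) + 1))"
    using strip_bound by blast
  obtain c where c: "\<And>g a. g \<in> carrier G \<Longrightarrow> a \<in> A \<Longrightarrow> length (rep (g \<otimes> p a)) \<le> length (rep g) + c"
    using length_rep_mult by blast
  have "linearly_fillable (C * (c + 1) + c) (lift (p a))" unfolding linearly_fillable_def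
  proof (intro conjI ballI)
    fix g assume g: "g \<in> carrier G"
    let ?l = "length (rep g)"
    show "length (rep (g \<otimes> \<pi> (lift (p a)))) \<le> ?l + (C * (c + 1) + c)"
      using c[OF g a] a by simp
    have "max ?l (length (rep (g \<otimes> p a))) + 1 \<le> (c + 1) * (?l + 1)"
      using c[OF g a] by (simp add: algebra_simps)
    then have "C * (max ?l (length (rep (g \<otimes> p a))) + 1) \<le> C * ((c + 1) * (?l + 1))"
      by (rule mult_le_mono2)
    then have "B (C * (max ?l (length (rep (g \<otimes> p a))) + 1)) \<subseteq> B ((C * (c + 1) + c) * (?l + 1))"
      by (intro B_mono) (simp only: add_mult_distrib mult.assoc trans_le_add1)
    then show "val (rep g) \<otimes>\<^bsub>F\<^esub> lift (p a) \<otimes>\<^bsub>F\<^esub> inv\<^bsub>F\<^esub> val (rep (g \<otimes> \<pi> (lift (p a))))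
        \<in> B ((C * (c + 1) + c) * (?l + 1))"
      using C[OF rep_neighbour[OF g a]] a by auto
  qed (use a in simp)
  then show ?thesis ..
qed

text \<open>A word \<open>w\<close> spelling \<open>\<pi> f\<close> is handled generator by
  generator, and \<open>f\<close> differs from \<open>val w\<close> by an element of the
  kernel.\<close>

lemma all_linearly_fillable:
  assumes f: "f \<in> carrier F"
  shows "\<exists>C. linearly_fillable C f"
proof -
  have val: "\<exists>C. linearly_fillable C (val w)" if "w \<in> lists A" for w
    using that
  proof induction
    case Nil
    show ?case by (rule linearly_fillable_kernel) (simp add: val_def kernel_def)
  next
    case (Cons a w)
    have "val (a # w) = lift (p a) \<otimes>\<^bsub>F\<^esub> val w" by (simp add: val_def)
    then show ?case
      using Cons linearly_fillable_generator linearly_fillable_mult by metis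
  qed
  have "\<pi> f \<in> carrier G" using f by simp
  then obtain w where w: "w \<in> lists A" "word_value G p w = \<pi> f"
    using semigroup_generated by blast
  then have "inv\<^bsub>F\<^esub> val w \<otimes>\<^bsub>F\<^esub> f \<in> kernel F G \<pi>" using f by (simp add: kernel_def)
  moreover have "f = val w \<otimes>\<^bsub>F\<^esub> (inv\<^bsub>F\<^esub> val w \<otimes>\<^bsub>F\<^esub> f)" using w f by simp
  ultimately show ?thesis
    using val[OF w(1)] linearly_fillable_kernel linearly_fillable_mult by metis
qed

text \<open>The word is swept letter by letter. After \<open>n\<close> letters the representative
  has length linear in \<open>n\<close>, so each further strip costs linear area, and the total is
  quadratic.\<close>

theorem quadratic_filling:
  assumes "finite Y" "Y \<subseteq> carrier F"
  obtains C where "\<And>us. us \<in> lists Y \<Longrightarrow> word_value F (\<lambda>u. u) us \<in> kernel F G \<pi> \<Longrightarrow>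
    word_value F (\<lambda>u. u) us \<in> B (C * (length us + 1)^2)"
proof -
  have "\<exists>C. \<forall>f\<in>Y. linearly_fillable C f" using assms
  proof induction
    case (insert f Y)
    then have "\<exists>C. \<forall>f\<in>Y. linearly_fillable C f" by simp
    then obtain C where "\<forall>f\<in>Y. linearly_fillable C f" by blast
    moreover obtain C' where "linearly_fillable C' f"
      using all_linearly_fillable[of f] insert by auto
    ultimately have "\<forall>f\<in>insert f Y. linearly_fillable (max C C') f"
      using linearly_fillable_mono by (metis insert_iff max.cobounded1 max.cobounded2)
    then show ?case ..
  qed simp
  then obtain C where C: "\<And>f. f \<in> Y \<Longrightarrow> linearly_fillable C f" by blast
  let ?U = "word_value F (\<lambda>u. u)" and ?v = "val (rep \<one>)" and ?l = "length (rep \<one>)"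
  have Y: "(\<lambda>u. u) ` Y \<subseteq> carrier F" using assms by simp
  have U: "?U us \<in> carrier F" if "us \<in> lists Y" for us using that Y by blast
  obtain c where c: "\<one>\<^bsub>F\<^esub> \<in> B c" using B_kernel[of "\<one>\<^bsub>F\<^esub>"] by (auto simp: kernel_def)
  \<comment> \<open>Here \<open>c\<close> pays for the empty word, and the other summand for a
    single letter, as \<open>length (rep ?g) + 1 \<le> (?l + C + 1) * (?n + 1)\<close>.\<close>
  define K where "K = c + C * (?l + C + 1)"
  have E: "length (rep (\<pi> (?U us))) \<le> ?l + C * length us \<and>
      ?v \<otimes>\<^bsub>F\<^esub> ?U us \<otimes>\<^bsub>F\<^esub> inv\<^bsub>F\<^esub> val (rep (\<pi> (?U us))) \<in> B (K * (length us + 1)^2)"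
    if "us \<in> lists Y" for us
    using that
  proof (induction us rule: rev_induct)
    case Nil
    then show ?case using c B_mono[of c K] by (auto simp: K_def)
  next
    case (snoc u us)
    then have us: "us \<in> lists Y" and u: "u \<in> Y" by auto
    then have uF: "u \<in> carrier F" "linearly_fillable C u" using assms C by auto
    note UF = U[OF us]
    let ?n = "length us" and ?g = "\<pi> (?U us)"
    have Us: "?U (us @ [u]) = ?U us \<otimes>\<^bsub>F\<^esub> u" using us u uF by (simp add: F.word_value_append[OF Y])
    have l: "length (rep ?g) \<le> ?l + C * ?n" using snoc us by blast
    have step: "length (rep (?g \<otimes> \<pi> u)) \<le> length (rep ?g) + C"
        "val (rep ?g) \<otimes>\<^bsub>F\<^esub> u \<otimes>\<^bsub>F\<^esub> inv\<^bsub>F\<^esub> val (rep (?g \<otimes> \<pi> u)) \<in> B (C * (length (rep ?g) + 1))"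
      using uF UF unfolding linearly_fillable_def by auto
    have "C * (length (rep ?g) + 1) \<le> C * ((?l + C + 1) * (?n + 1))"
      using l by (intro mult_le_mono2) (simp add: algebra_simps)
    also have "\<dots> \<le> K * (?n + 1)" unfolding K_def by (simp only: add_mult_distrib mult.assoc trans_le_add2)
    finally have "K * (?n + 1)^2 + C * (length (rep ?g) + 1) \<le> K * (?n + 1)^2 + K * (?n + 1)"
      by (rule add_left_mono)
    also have "\<dots> \<le> K * (?n + 1 + 1)^2" by (simp add: power2_eq_square algebra_simps)
    finally have le: "B (K * (?n + 1)^2 + C * (length (rep ?g) + 1)) \<subseteq> B (K * (?n + 1 + 1)^2)"
      by (rule B_mono)
    have "?v \<otimes>\<^bsub>F\<^esub> (?U us \<otimes>\<^bsub>F\<^esub> u) \<otimes>\<^bsub>F\<^esub> inv\<^bsub>F\<^esub> val (rep (?g \<otimes> \<pi> u)) =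
      (?v \<otimes>\<^bsub>F\<^esub> ?U us \<otimes>\<^bsub>F\<^esub> inv\<^bsub>F\<^esub> val (rep ?g)) \<otimes>\<^bsub>F\<^esub>
      (val (rep ?g) \<otimes>\<^bsub>F\<^esub> u \<otimes>\<^bsub>F\<^esub> inv\<^bsub>F\<^esub> val (rep (?g \<otimes> \<pi> u)))"
      using UF uF by (simp add: F.m_assoc)
    also have "\<dots> \<in> B (K * (?n + 1)^2 + C * (length (rep ?g) + 1))"
      using snoc us step by (intro B_mult) auto
    finally show ?case using le l step(1) UF uF unfolding Us by auto
  qed
  have "?U us \<in> B (K * (length us + 1)^2)" if us: "us \<in> lists Y" and k: "?U us \<in> kernel F G \<pi>" for us
  proof -
    have "\<pi> (?U us) = \<one>" using k by (simp add: kernel_def)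
    \<comment> \<open>The last representative is again \<open>rep \<one>\<close>, so the swept loop
      is a conjugate of \<open>?U us\<close>; conjugating back costs no area.\<close>
    then have "?v \<otimes>\<^bsub>F\<^esub> ?U us \<otimes>\<^bsub>F\<^esub> inv\<^bsub>F\<^esub> ?v \<in> B (K * (length us + 1)^2)" using E[OF us] by simp
    then have "inv\<^bsub>F\<^esub> ?v \<otimes>\<^bsub>F\<^esub> (?v \<otimes>\<^bsub>F\<^esub> ?U us \<otimes>\<^bsub>F\<^esub> inv\<^bsub>F\<^esub> ?v) \<otimes>\<^bsub>F\<^esub> inv\<^bsub>F\<^esub> (inv\<^bsub>F\<^esub> ?v)
        \<in> B (K * (length us + 1)^2)"
      by (rule B_conj) simp
    then show ?thesis using U[OF us] by (simp add: F.m_assoc)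
  qed
  then show thesis using that by blast
qed

end

section \<open>Baumslag--Solitar relations\<close>

context group
begin

lemma commutator_closed [simp]:
  "x \<in> carrier G \<Longrightarrow> y \<in> carrier G \<Longrightarrow> commutator G x y \<in> carrier G"
  by (simp add: commutator_def)

lemma mult_commutator:
  "x \<in> carrier G \<Longrightarrow> y \<in> carrier G \<Longrightarrow> y \<otimes> x \<otimes> commutator G x y = x \<otimes> y"
  by (simp add: commutator_def m_assoc)

text \<open>This form avoids inverses, which is convenient for permutations given by
  formulas.\<close>

lemma commutator_eqI:
  assumes "y \<otimes> x \<otimes> g = x \<otimes> y" "x \<in> carrier G" "y \<in> carrier G" "g \<in> carrier G"
  shows "commutator G x y = g"
proof -
  have "y \<otimes> x \<otimes> commutator G x y = y \<otimes> x \<otimes> g" using assms mult_commutator by simp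
  then show ?thesis using assms by (metis commutator_closed l_cancel m_closed)
qed

lemma commutator_eq_one_iff:
  assumes "x \<in> carrier G" "y \<in> carrier G"
  shows "commutator G x y = \<one> \<longleftrightarrow> x \<otimes> y = y \<otimes> x"
  using commutator_eqI[of y x \<one>] mult_commutator[of x y] assms by auto

definition relator :: "'a \<Rightarrow> 'a \<Rightarrow> nat \<Rightarrow> 'a" where
  "relator y z m = commutator G (y \<otimes> commutator G z y [^] m) z"

definition witness :: "'a \<Rightarrow> 'a \<Rightarrow> nat \<Rightarrow> 'a" where
  "witness g z n = commutator G g (inv (z [^] n) \<otimes> g \<otimes> z [^] n)"

lemma relator_closed [simp]: "y \<in> carrier G \<Longrightarrow> z \<in> carrier G \<Longrightarrow> relator y z m \<in> carrier G"
  by (simp add: relator_def)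

lemma witness_closed [simp]: "g \<in> carrier G \<Longrightarrow> z \<in> carrier G \<Longrightarrow> witness g z n \<in> carrier G"
  by (simp add: witness_def)

text \<open>With \<open>g = [z, y]\<close> the relation reads \<open>z\<^sup>-\<^sup>1 g\<^sup>m z = g\<^sup>m\<^sup>+\<^sup>1\<close>, that of the Baumslag--Solitar group \<open>BS(m, m + 1)\<close>.\<close>

lemma relator_eq_one_iff:
  assumes y: "y \<in> carrier G" and z: "z \<in> carrier G" and g: "commutator G z y = g"
  shows "relator y z m = \<one> \<longleftrightarrow> g [^] m \<otimes> z = z \<otimes> g [^] Suc m"
proof -
  have gG: "g \<in> carrier G" using assms by auto
  have "z \<otimes> (y \<otimes> g [^] m) = y \<otimes> z \<otimes> g \<otimes> g [^] m"
    using mult_commutator[OF z y] gG y z unfolding g by (simp add: m_assoc)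
  also have "\<dots> = y \<otimes> (z \<otimes> g [^] Suc m)"
    using gG y z nat_pow_Suc2[OF gG, of m] by (simp add: m_assoc del: nat_pow_Suc)
  finally have "z \<otimes> (y \<otimes> g [^] m) = y \<otimes> (z \<otimes> g [^] Suc m)" .
  then show ?thesis using gG y z unfolding relator_def g
    by (simp add: commutator_eq_one_iff m_assoc del: nat_pow_Suc)
qed

lemma pow_mult_swap:
  assumes "h \<otimes> z = z \<otimes> h'" "h \<in> carrier G" "h' \<in> carrier G" "z \<in> carrier G"
  shows "h [^] (k::nat) \<otimes> z = z \<otimes> h' [^] k"
proof (induction k)
  case (Suc k)
  have "h [^] Suc k \<otimes> z = h [^] k \<otimes> z \<otimes> h'" using assms by (simp add: m_assoc)
  also have "\<dots> = z \<otimes> h' [^] Suc k" using assms Suc by (simp add: m_assoc)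
  finally show ?case .
qed (use assms in simp)

lemma pow_two: "x \<in> carrier G \<Longrightarrow> x [^] (2::nat) = x \<otimes> x"
  by (simp add: numeral_2_eq_2)

lemma pow_commute:
  assumes "x \<in> carrier G"
  shows "x \<otimes> x [^] (n::nat) = x [^] n \<otimes> x"
  using nat_pow_Suc2[OF assms] by simp

text \<open>A conjugate of \<open>g\<^sup>2\<close> equals \<open>g\<^sup>3\<close>, so in a finite group \<open>g\<close> has odd order and is a power of \<open>g\<^sup>2\<close>.\<close>

lemma finite_witness_eq_one:
  assumes fin: "finite (carrier G)" and g: "g \<in> carrier G" and z: "z \<in> carrier G"
    and rel: "g [^] (2::nat) \<otimes> z = z \<otimes> g [^] (3::nat)"
  shows "witness g z 1 = \<one>"
proof -
  have pos: "ord g > 0" using ord_ge_1[OF fin g] by simp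
  \<comment> \<open>If \<open>ord g = 2 * k\<close>, then the \<open>k\<close>-th power of
    \<open>g^2\<close> is trivial, and so is that of its conjugate \<open>g^3\<close>; hence
    \<open>2 * k\<close> divides \<open>3 * k\<close>.\<close>
  have "odd (ord g)"
  proof
    assume "even (ord g)"
    then obtain k where k: "ord g = 2 * k" by blast
    have "(g [^] (2::nat)) [^] k \<otimes> z = z \<otimes> (g [^] (3::nat)) [^] k"
      using pow_mult_swap[OF rel] g z by simp
    moreover have "(g [^] (2::nat)) [^] k = \<one>" using g k by (metis nat_pow_pow pow_ord_eq_1)
    ultimately have "g [^] (3 * k) = \<one>" using g z by (simp add: nat_pow_pow)
    then have "2 * k dvd 3 * k" using g k by (simp add: pow_eq_id)
    then show False using k pos by (auto simp: dvd_mult_cancel_right)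
  qed
  then obtain k where k: "ord g + 1 = 2 * k" by (metis even_add odd_one evenE)
  have gk: "(g [^] (2::nat)) [^] k = g"
    using g k by (metis Suc_eq_plus1 l_one nat_pow_Suc nat_pow_pow pow_ord_eq_1)
  \<comment> \<open>Since \<open>g = (g^2)^k\<close>, its conjugate by \<open>z\<close> is
    \<open>(g^3)^k\<close>, which commutes with \<open>g\<close>.\<close>
  have "g \<otimes> z = z \<otimes> g [^] (3 * k)"
    using pow_mult_swap[OF rel, of k] g z unfolding gk by (simp add: nat_pow_pow)
  then have "inv z \<otimes> g \<otimes> z = g [^] (3 * k)"
    using g z by (simp add: m_assoc)
  then show ?thesis
    unfolding witness_def using g z by (simp add: commutator_eq_one_iff pow_commute)
qed

text \<open>The conjugate \<open>z^-1 g^2 z\<close> is \<open>g^3\<close>, which commutes with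
  \<open>g^2\<close>. An endomorphism that fixes \<open>z\<close> and squares \<open>g\<close>
  therefore kills the witness of \<open>g\<close>.\<close>

lemma witness_square_eq_one:
  assumes g: "g \<in> carrier G" and z: "z \<in> carrier G"
    and rel: "g [^] (2::nat) \<otimes> z = z \<otimes> g [^] (3::nat)"
  shows "witness (g [^] (2::nat)) z 1 = \<one>"
proof -
  have "inv z \<otimes> g [^] (2::nat) \<otimes> z = g [^] (3::nat)"
    using rel g z by (simp add: m_assoc)
  then show ?thesis
    unfolding witness_def using g z by (simp add: commutator_eq_one_iff nat_pow_mult)
qed

text \<open>Conjugation by \<open>z^n\<close> turns \<open>g\<close> into \<open>g^(2^n)\<close>, so
  the witness is a commutator of two powers of \<open>g\<close>.\<close>

lemma witness_eq_one:
  assumes g: "g \<in> carrier G" and z: "z \<in> carrier G" and rel: "g \<otimes> z = z \<otimes> g [^] (2::nat)"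
  shows "witness g z n = \<one>"
proof -
  have "g \<otimes> z [^] n = z [^] n \<otimes> g [^] (2 ^ n :: nat)"
  proof (induction n)
    case (Suc n)
    have "g \<otimes> z [^] Suc n = z [^] n \<otimes> (g [^] (2 ^ n :: nat) \<otimes> z)"
      using Suc g z by (simp flip: m_assoc)
    also have "\<dots> = z [^] n \<otimes> (z \<otimes> (g [^] (2::nat)) [^] (2 ^ n :: nat))"
      using pow_mult_swap[OF rel] g z by simp
    also have "\<dots> = z [^] Suc n \<otimes> g [^] (2 ^ Suc n :: nat)"
      using g z by (simp add: m_assoc nat_pow_pow)
    finally show ?case .
  qed (use g z in simp)
  then have "inv (z [^] n) \<otimes> g \<otimes> z [^] n = g [^] (2 ^ n :: nat)"
    using g z by (simp add: m_assoc)
  then show ?thesis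
    unfolding witness_def using g z by (simp add: commutator_eq_one_iff pow_commute)
qed

end

context group_hom
begin

lemma hom_commutator:
  "x \<in> carrier G \<Longrightarrow> y \<in> carrier G \<Longrightarrow> h (commutator G x y) = commutator H (h x) (h y)"
  by (simp add: commutator_def)

lemma hom_relator:
  "y \<in> carrier G \<Longrightarrow> z \<in> carrier G \<Longrightarrow> h (G.relator y z m) = H.relator (h y) (h z) m"
  by (simp add: G.relator_def H.relator_def hom_commutator hom_nat_pow)

lemma hom_witness:
  "g \<in> carrier G \<Longrightarrow> z \<in> carrier G \<Longrightarrow> h (G.witness g z n) = H.witness (h g) (h z) n"
  by (simp add: G.witness_def H.witness_def hom_commutator hom_nat_pow)

end

section \<open>Presentations: generators, quotient map, universal property\<close>

lemma free_group_subset_subgroup: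
  assumes "subgroup K (free_group S)" "\<And>x. x \<in> S \<Longrightarrow> [(x, True)] \<in> K"
  shows "carrier (free_group S) \<subseteq> K"
proof
  interpret F: group "free_group S" by (rule group_free_group)
  interpret K: subgroup K "free_group S" by fact
  have letter: "[l] \<in> K" if l: "fst l \<in> S" for l
  proof (cases "snd l")
    case True
    then show ?thesis using l assms(2) by (cases l) auto
  next
    case False
    then obtain x where x: "l = (x, False)" "x \<in> S" using l by (cases l) auto
    have "inv\<^bsub>free_group S\<^esub> [(x, True)] = [(x, False)]"
      by (rule F.inv_equality) (use x in \<open>auto simp: free_group_def reduced_Cons inv_letter_def\<close>)
    then show ?thesis using x assms(2) K.m_inv_closed by metis
  qed
  fix w assume "w \<in> carrier (free_group S)"
  then show "w \<in> K"
  proof (induction w)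
    case Nil
    then show ?case using K.one_closed by (simp add: free_group_def)
  next
    case (Cons l w)
    then have w: "w \<in> carrier (free_group S)" and l: "fst l \<in> S"
      by (auto simp: free_group_def reduced_Cons)
    have "l # w = [l] \<otimes>\<^bsub>free_group S\<^esub> w"
      using Cons.prems by (cases w) (auto simp: free_group_def reduced_Cons)
    then show ?case using K.m_closed[OF letter[OF l] Cons.IH[OF w]] by simp
  qed
qed

definition quotient_map :: "'a set \<Rightarrow> 'a letter list \<Rightarrow> 'a letter list \<Rightarrow> 'a letter list set" where
  "quotient_map S r w = normal_closure (free_group S) r #>\<^bsub>free_group S\<^esub> w"

lemma quotient_map_hom:
  assumes "r \<in> carrier (free_group S)"
  shows "quotient_map S r \<in> hom (free_group S) (one_relator_group S r)"
  unfolding quotient_map_def one_relator_group_def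
  using group.normal_closure_normal[OF group_free_group assms] by (rule normal.r_coset_hom_Mod)

lemma quotient_map_surj:
  "quotient_map S r ` carrier (free_group S) = carrier (one_relator_group S r)"
  by (simp add: quotient_map_def one_relator_group_def carrier_FactGroup)

lemma quotient_map_eq_one_iff:
  assumes "r \<in> carrier (free_group S)" "w \<in> carrier (free_group S)"
  shows "quotient_map S r w = \<one>\<^bsub>one_relator_group S r\<^esub> \<longleftrightarrow> w \<in> normal_closure (free_group S) r"
proof -
  interpret F: group "free_group S" by (rule group_free_group)
  have "subgroup (normal_closure (free_group S) r) (free_group S)"
    using F.normal_closure_normal[OF assms(1)] by (simp add: normal_imp_subgroup)
  then show ?thesis
    using assms(2) F.coset_join1 F.coset_join2 F.rcos_self
    by (auto simp: quotient_map_def one_relator_group_def)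
qed

lemma normal_closure_minimal: "N \<lhd> G \<Longrightarrow> r \<in> N \<Longrightarrow> normal_closure G r \<subseteq> N"
  by (auto simp: normal_closure_def)

lemma mem_normal_closure: "r \<in> normal_closure G r"
  by (auto simp: normal_closure_def)

lemma normal_closure_subset_kernel:
  assumes "group_hom G H h" "r \<in> carrier G" "h r = \<one>\<^bsub>H\<^esub>"
  shows "normal_closure G r \<subseteq> kernel G H h"
  using group_hom.normal_kernel[OF assms(1)] assms(2,3)
  by (intro normal_closure_minimal) (simp_all add: kernel_def)

text \<open>Von Dyck's theorem: the kernel of \<open>\<phi>\<close> is a normal subgroup containing
  \<open>r\<close>, so it contains the normal closure.\<close>

lemma one_relator_group_universal:
  assumes "r \<in> carrier (free_group S)" "group H" "\<phi> \<in> hom (free_group S) H" "\<phi> r = \<one>\<^bsub>H\<^esub>"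
  obtains \<psi> where "\<psi> \<in> hom (one_relator_group S r) H"
    "\<And>w. w \<in> carrier (free_group S) \<Longrightarrow> \<psi> (quotient_map S r w) = \<phi> w"
proof -
  interpret group_hom "free_group S" H \<phi>
    using assms group_free_group by (simp add: group_hom_def group_hom_axioms_def)
  have "normal_closure (free_group S) r \<subseteq> kernel (free_group S) H \<phi>"
    using assms by (intro normal_closure_subset_kernel group_hom_axioms) auto
  then show thesis
    using FactGroup_universal_kernel[OF G.normal_closure_normal[OF assms(1)]] that
    unfolding one_relator_group_def quotient_map_def by blast
qed

section \<open>Permutation groups\<close>

definition perm_group :: "('a \<Rightarrow> 'a) monoid" where
  "perm_group = \<lparr>carrier = {f. bij f}, monoid.mult = (\<circ>), one = id\<rparr>"

lemma perm_group_simps [simp]: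
  "f \<in> carrier perm_group \<longleftrightarrow> bij f"
  "f \<otimes>\<^bsub>perm_group\<^esub> g = f \<circ> g"
  "\<one>\<^bsub>perm_group\<^esub> = id"
  by (simp_all add: perm_group_def)

lemma group_perm_group: "group perm_group"
proof (rule groupI)
  fix f :: "'a \<Rightarrow> 'a" assume "f \<in> carrier perm_group"
  then show "\<exists>g\<in>carrier perm_group. g \<otimes>\<^bsub>perm_group\<^esub> f = \<one>\<^bsub>perm_group\<^esub>"
    by (intro bexI[of _ "inv_into UNIV f"]) (auto simp: bij_imp_bij_inv bij_is_inj)
qed (auto simp: bij_comp o_assoc)

lemma perm_group_pow: "f [^]\<^bsub>perm_group\<^esub> n = f ^^ n"
  by (induction n) (simp_all add: nat_pow_def perm_group_def funpow_swap1 fun_eq_iff)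

section \<open>The one-relator groups \<open>BSZ m\<close>\<close>

abbreviation F2 :: "nat letter list monoid" where
  "F2 \<equiv> free_group {0, Suc 0}"

interpretation F2: group F2
  by (rule group_free_group)

definition gen_y :: "nat letter list" where "gen_y = [(0, True)]"
definition gen_z :: "nat letter list" where "gen_z = [(Suc 0, True)]"

abbreviation gen_g :: "nat letter list" where
  "gen_g \<equiv> commutator F2 gen_z gen_y"

abbreviation rel :: "nat \<Rightarrow> nat letter list" where
  "rel m \<equiv> F2.relator gen_y gen_z m"

abbreviation BSZ :: "nat \<Rightarrow> nat letter list set monoid" where
  "BSZ m \<equiv> one_relator_group {0, Suc 0} (rel m)"

abbreviation BSZ_map :: "nat \<Rightarrow> nat letter list \<Rightarrow> nat letter list set" where
  "BSZ_map m \<equiv> quotient_map {0, Suc 0} (rel m)"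

lemma gens_closed [simp]: "gen_y \<in> carrier F2" "gen_z \<in> carrier F2"
  by (auto simp: free_group_def gen_y_def gen_z_def reduced_Cons)

lemma F2_subset_subgroup:
  "subgroup K F2 \<Longrightarrow> gen_y \<in> K \<Longrightarrow> gen_z \<in> K \<Longrightarrow> carrier F2 \<subseteq> K"
  by (rule free_group_subset_subgroup) (auto simp: gen_y_def gen_z_def)

lemma F2_hom:
  assumes "group H" "a \<in> carrier H" "b \<in> carrier H"
  obtains \<phi> where "\<phi> \<in> hom F2 H" "\<phi> gen_y = a" "\<phi> gen_z = b"
proof -
  have "(\<lambda>x::nat. if x = 0 then a else b) \<in> {0, Suc 0} \<rightarrow> carrier H" using assms by auto
  from free_group_universal[OF assms(1) this]
  obtain \<phi> where "\<phi> \<in> hom F2 H" "\<forall>x\<in>{0, Suc 0}. \<phi> [(x, True)] = (if x = 0 then a else b)" by blast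
  then show thesis using that by (auto simp: gen_y_def gen_z_def)
qed

lemma group_hom_BSZ_map: "group_hom F2 (BSZ m) (BSZ_map m)"
  using quotient_map_hom[of "rel m"] group_one_relator_group[of "rel m"]
  by (simp add: group_hom_def group_hom_axioms_def F2.group_axioms)

lemma BSZ_relation:
  fixes m
  defines "g \<equiv> BSZ_map m gen_g" and "z \<equiv> BSZ_map m gen_z"
  shows "g [^]\<^bsub>BSZ m\<^esub> m \<otimes>\<^bsub>BSZ m\<^esub> z = z \<otimes>\<^bsub>BSZ m\<^esub> g [^]\<^bsub>BSZ m\<^esub> Suc m"
proof -
  interpret group_hom F2 "BSZ m" "BSZ_map m" by (rule group_hom_BSZ_map)
  have "BSZ_map m (rel m) = \<one>\<^bsub>BSZ m\<^esub>"
    by (simp add: quotient_map_eq_one_iff mem_normal_closure)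
  then have "H.relator (BSZ_map m gen_y) z m = \<one>\<^bsub>BSZ m\<^esub>"
    by (simp add: hom_relator z_def)
  moreover have "commutator (BSZ m) z (BSZ_map m gen_y) = g"
    by (simp add: hom_commutator g_def z_def)
  ultimately show ?thesis
    by (subst (asm) H.relator_eq_one_iff) (auto simp: z_def)
qed

lemma bij_of_inverse: "(\<And>x. g (f x) = x) \<Longrightarrow> (\<And>x. f (g x) = x) \<Longrightarrow> bij f"
  by (metis bijI')

text \<open>
  The action is on \<open>\<int> \<times> \<int>\<close>, with \<open>g\<close> the translation of the first coordinate by 1. The second coordinate
  makes the numbers of orbits of \<open>g\<^sup>2\<close> and \<open>g\<^sup>3\<close> equal, and \<open>z\<close> matches these orbits.
\<close>

lemma BSZ_2_witness_nontrivial: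
  "BSZ_map 2 (F2.witness gen_g gen_z 1) \<noteq> \<one>\<^bsub>BSZ 2\<^esub>"
proof
  \<comment> \<open>This is the inverse of \<open>g^2\<close>, so \<open>y g^2\<close> is trivial
    and the relator with it. Both \<open>[z, y] = g\<close> and the relation come down to
    \<open>z g^3 = g^2 z\<close>.\<close>
  define y :: "int \<times> int \<Rightarrow> int \<times> int" where "y = (\<lambda>(n, j). (n - 2, j))"
  define g :: "int \<times> int \<Rightarrow> int \<times> int" where "g = (\<lambda>(n, j). (n + 1, j))"
  \<comment> \<open>The orbits of \<open>g^3\<close> are numbered by \<open>3 * j + n mod 3\<close>,
    those of \<open>g^2\<close> by \<open>2 * j + n mod 2\<close>; \<open>z\<close> preserves the
    number of the orbit and the position in it.\<close>
  define z :: "int \<times> int \<Rightarrow> int \<times> int" where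
    "z = (\<lambda>(n, j). (2 * (n div 3) + (3 * j + n mod 3) mod 2, (3 * j + n mod 3) div 2))"
  define z' :: "int \<times> int \<Rightarrow> int \<times> int" where
    "z' = (\<lambda>(n, j). (3 * (n div 2) + (2 * j + n mod 2) mod 3, (2 * j + n mod 2) div 3))"
  interpret P: group "perm_group :: (int \<times> int \<Rightarrow> int \<times> int) monoid" by (rule group_perm_group)
  have "bij y" by (rule bij_of_inverse[of "\<lambda>(n, j). (n + 2, j)"]) (auto simp: y_def)
  moreover have "bij g" by (rule bij_of_inverse[of "\<lambda>(n, j). (n - 1, j)"]) (auto simp: g_def)
  moreover have "bij z"
  proof (rule bij_of_inverse[of z'])
    fix x
    show "z' (z x) = x" by (cases x) (simp add: z_def z'_def)
    show "z (z' x) = x" by (cases x) (simp add: z_def z'_def)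
  qed
  ultimately have bij [simp]: "bij y" "bij g" "bij z" by blast+
  obtain \<phi> where \<phi>: "\<phi> \<in> hom F2 perm_group" "\<phi> gen_y = y" "\<phi> gen_z = z"
    by (rule F2_hom[OF P.group_axioms, of y z]) auto
  interpret \<phi>: group_hom F2 perm_group \<phi>
    by unfold_locales (rule \<phi>)
  have zg3: "z (n + 3, j) = (fst (z (n, j)) + 2, snd (z (n, j)))" for n j
    by (simp add: z_def)
  have g: "commutator perm_group z y = g"
  proof (rule P.commutator_eqI)
    have "y (z (g (n, j))) = z (y (n, j))" for n j
      using zg3[of "n - 2" j] by (cases "z (n - 2, j)") (simp add: y_def g_def add.commute)
    then show "y \<otimes>\<^bsub>perm_group\<^esub> z \<otimes>\<^bsub>perm_group\<^esub> g = z \<otimes>\<^bsub>perm_group\<^esub> y"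
      by (auto simp: fun_eq_iff)
  qed auto
  have "g [^]\<^bsub>perm_group\<^esub> (2::nat) \<otimes>\<^bsub>perm_group\<^esub> z = z \<otimes>\<^bsub>perm_group\<^esub> g [^]\<^bsub>perm_group\<^esub> Suc 2"
  proof -
    have "g (g (z (n, j))) = z (g (g (g (n, j))))" for n j
      using zg3[of n j] by (cases "z (n, j)") (simp add: g_def add.commute)
    then show ?thesis by (auto simp: fun_eq_iff perm_group_pow numeral_2_eq_2)
  qed
  then have "P.relator y z 2 = \<one>\<^bsub>perm_group\<^esub>"
    using P.relator_eq_one_iff[OF _ _ g, of 2] by simp
  then have "\<phi> (rel 2) = \<one>\<^bsub>perm_group\<^esub>" using \<phi> by (simp add: \<phi>.hom_relator)
  then have sub: "normal_closure F2 (rel 2) \<subseteq> kernel F2 perm_group \<phi>"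
    by (intro normal_closure_subset_kernel) (auto intro: \<phi>.group_hom_axioms)
  define h where "h = inv\<^bsub>perm_group\<^esub> z \<otimes>\<^bsub>perm_group\<^esub> g \<otimes>\<^bsub>perm_group\<^esub> z"
  have h_bij: "h \<in> carrier perm_group"
    unfolding h_def by (intro P.m_closed P.inv_closed) auto
  assume "BSZ_map 2 (F2.witness gen_g gen_z 1) = \<one>\<^bsub>BSZ 2\<^esub>"
  then have "F2.witness gen_g gen_z 1 \<in> kernel F2 perm_group \<phi>"
    using sub by (subst (asm) quotient_map_eq_one_iff) auto
  then have "P.witness g z 1 = \<one>\<^bsub>perm_group\<^esub>"
    using \<phi> g by (simp add: kernel_def \<phi>.hom_witness \<phi>.hom_commutator)
  then have gh: "commutator perm_group g h = \<one>\<^bsub>perm_group\<^esub>"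
    by (simp only: P.witness_def h_def) (simp add: P.nat_pow_eone)
  then have "g \<circ> h = h \<circ> g"
    using P.commutator_eq_one_iff[OF _ h_bij] by simp
  moreover have "z \<otimes>\<^bsub>perm_group\<^esub> h = g \<otimes>\<^bsub>perm_group\<^esub> z"
  proof -
    have c: "z \<in> carrier perm_group" "g \<in> carrier perm_group" by simp_all
    then show ?thesis
      using P.inv_closed[OF c(1)] unfolding h_def
      by (simp only: P.m_assoc P.m_closed P.inv_cancel_left)
  qed
  then have zh: "z (h x) = g (z x)" for x
    unfolding perm_group_simps by (metis comp_apply)
  \<comment> \<open>Here \<open>h\<close> sends \<open>(0, 0)\<close> to \<open>(1, 0)\<close> and
    \<open>(1, 0)\<close> to \<open>(3, 0)\<close>. So \<open>h g\<close> sends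
    \<open>(0, 0)\<close> to \<open>(3, 0)\<close>, while \<open>g h\<close> sends it to
    \<open>(2, 0)\<close>.\<close>
  have "z (h (0, 0)) = z (1, 0)" "z (h (1, 0)) = z (3, 0)"
    unfolding zh by (simp_all add: z_def g_def)
  then have "h (0, 0) = (1, 0)" "h (1, 0) = (3, 0)"
    using bij_is_inj[OF bij(3)] by (simp_all only: inj_eq)
  ultimately show False by (auto simp: fun_eq_iff g_def dest!: spec[of _ 0])
qed

section \<open>Failure of residual finiteness and of Hopficity\<close>

theorem BSZ_2_not_residually_finite: "\<not> residually_finite (BSZ 2)"
proof
  interpret pi: group_hom F2 "BSZ 2" "BSZ_map 2" by (rule group_hom_BSZ_map)
  let ?g = "BSZ_map 2 gen_g" and ?z = "BSZ_map 2 gen_z"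
  let ?w = "pi.H.witness ?g ?z 1"
  assume rf: "residually_finite (BSZ 2)"
  have "?w \<in> N" if N: "N \<lhd> BSZ 2" "finite (carrier (BSZ 2 Mod N))" for N
  proof -
    interpret N: normal N "BSZ 2" by fact
    interpret q: group_hom "BSZ 2" "BSZ 2 Mod N" "\<lambda>x. N #>\<^bsub>BSZ 2\<^esub> x"
      by (simp add: group_hom_def group_hom_axioms_def N.factorgroup_is_group N.r_coset_hom_Mod)
    have "(N #>\<^bsub>BSZ 2\<^esub> (?g [^]\<^bsub>BSZ 2\<^esub> (2::nat) \<otimes>\<^bsub>BSZ 2\<^esub> ?z)) =
      (N #>\<^bsub>BSZ 2\<^esub> (?z \<otimes>\<^bsub>BSZ 2\<^esub> ?g [^]\<^bsub>BSZ 2\<^esub> Suc 2))"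
      by (simp only: BSZ_relation)
    then have "q.H.witness (N #>\<^bsub>BSZ 2\<^esub> ?g) (N #>\<^bsub>BSZ 2\<^esub> ?z) 1 = \<one>\<^bsub>BSZ 2 Mod N\<^esub>"
      using N(2) by (intro q.H.finite_witness_eq_one)
        (simp_all only: q.hom_mult q.hom_nat_pow q.hom_closed pi.hom_closed gens_closed
          F2.commutator_closed pi.H.nat_pow_closed pi.H.m_closed, simp add: numeral_3_eq_3)
    then have "N #>\<^bsub>BSZ 2\<^esub> ?w = N"
      using q.hom_witness[of ?g ?z 1] by simp
    then show ?thesis
      using pi.H.coset_join1[of N ?w] N.subset N.is_subgroup by simp
  qed
  then have "?w \<in> {\<one>\<^bsub>BSZ 2\<^esub>}" using rf unfolding residually_finite_def by blast
  then show False using BSZ_2_witness_nontrivial by (simp add: pi.hom_witness)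
qed

theorem BSZ_2_not_hopfian: "\<not> hopfian (BSZ 2)"
proof
  interpret pi: group_hom F2 "BSZ 2" "BSZ_map 2" by (rule group_hom_BSZ_map)
  let ?G = "BSZ 2"
  define y z g where "y = BSZ_map 2 gen_y" and "z = BSZ_map 2 gen_z" and "g = BSZ_map 2 gen_g"
  define g2 where "g2 = g [^]\<^bsub>?G\<^esub> (2::nat)"
  define y' where "y' = y \<otimes>\<^bsub>?G\<^esub> inv\<^bsub>?G\<^esub> g2"
  have c [simp]: "y \<in> carrier ?G" "z \<in> carrier ?G" "g \<in> carrier ?G" "g2 \<in> carrier ?G" "y' \<in> carrier ?G"
    by (auto simp: y_def z_def g_def g2_def y'_def)
  have yzg: "y \<otimes>\<^bsub>?G\<^esub> z \<otimes>\<^bsub>?G\<^esub> g = z \<otimes>\<^bsub>?G\<^esub> y"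
    using pi.H.mult_commutator[of z y] by (simp add: y_def z_def g_def pi.hom_commutator)
  have rel: "g2 \<otimes>\<^bsub>?G\<^esub> z = z \<otimes>\<^bsub>?G\<^esub> g [^]\<^bsub>?G\<^esub> (3::nat)"
    using BSZ_relation[of 2] by (simp add: g_def z_def g2_def numeral_3_eq_3 numeral_2_eq_2)
  have g3: "g [^]\<^bsub>?G\<^esub> (3::nat) = g \<otimes>\<^bsub>?G\<^esub> g2" "g [^]\<^bsub>?G\<^esub> (3::nat) = g2 \<otimes>\<^bsub>?G\<^esub> g"
    using pi.H.nat_pow_Suc2[OF c(3), of 2] pi.H.nat_pow_Suc[of g 2]
    by (simp_all add: g2_def del: pi.H.nat_pow_Suc)
  \<comment> \<open>The relation gives \<open>z g^2 = z g^3 g^-1 = g^2 z g^-1\<close>; this makes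
    \<open>[z, y']\<close> equal to \<open>g^2\<close>.\<close>
  have "inv\<^bsub>?G\<^esub> g2 \<otimes>\<^bsub>?G\<^esub> (z \<otimes>\<^bsub>?G\<^esub> g2) = z \<otimes>\<^bsub>?G\<^esub> inv\<^bsub>?G\<^esub> g"
  proof -
    have "z \<otimes>\<^bsub>?G\<^esub> g2 = z \<otimes>\<^bsub>?G\<^esub> (g2 \<otimes>\<^bsub>?G\<^esub> g) \<otimes>\<^bsub>?G\<^esub> inv\<^bsub>?G\<^esub> g"
      by (simp add: pi.H.m_assoc)
    also have "\<dots> = g2 \<otimes>\<^bsub>?G\<^esub> z \<otimes>\<^bsub>?G\<^esub> inv\<^bsub>?G\<^esub> g" using rel g3(2) by simp
    finally show ?thesis by (simp add: pi.H.m_assoc)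
  qed
  then have "y' \<otimes>\<^bsub>?G\<^esub> z \<otimes>\<^bsub>?G\<^esub> g2 = y \<otimes>\<^bsub>?G\<^esub> (z \<otimes>\<^bsub>?G\<^esub> inv\<^bsub>?G\<^esub> g)"
    by (simp add: y'_def pi.H.m_assoc)
  also have "\<dots> = y \<otimes>\<^bsub>?G\<^esub> z \<otimes>\<^bsub>?G\<^esub> g \<otimes>\<^bsub>?G\<^esub> inv\<^bsub>?G\<^esub> (g \<otimes>\<^bsub>?G\<^esub> g)"
    by (simp add: pi.H.m_assoc pi.H.inv_mult_group)
  also have "\<dots> = z \<otimes>\<^bsub>?G\<^esub> y'"
    unfolding yzg by (simp add: y'_def g2_def pi.H.m_assoc pi.H.pow_two)
  finally have g': "commutator ?G z y' = g2"
    by (intro pi.H.commutator_eqI) auto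
  obtain \<phi> where \<phi>: "\<phi> \<in> hom F2 ?G" "\<phi> gen_y = y'" "\<phi> gen_z = z"
    by (rule F2_hom[OF pi.H.group_axioms, of y' z]) auto
  interpret \<phi>: group_hom F2 ?G \<phi> by unfold_locales (rule \<phi>)
  \<comment> \<open>Squaring both sides of \<open>z^-1 g^2 z = g^3\<close> gives the same relation
    with \<open>g^2\<close> in place of \<open>g\<close>, so the relator in \<open>y'\<close> and
    \<open>z\<close> is trivial.\<close>
  have "g2 [^]\<^bsub>?G\<^esub> (2::nat) \<otimes>\<^bsub>?G\<^esub> z = z \<otimes>\<^bsub>?G\<^esub> (g [^]\<^bsub>?G\<^esub> (3::nat)) [^]\<^bsub>?G\<^esub> (2::nat)"
    by (rule pi.H.pow_mult_swap[OF rel]) auto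
  also have "(g [^]\<^bsub>?G\<^esub> (3::nat)) [^]\<^bsub>?G\<^esub> (2::nat) = g2 [^]\<^bsub>?G\<^esub> Suc 2"
    by (simp add: g2_def pi.H.nat_pow_pow del: pi.H.nat_pow_Suc)
  finally have "\<phi> (rel 2) = \<one>\<^bsub>?G\<^esub>"
    using \<phi> pi.H.relator_eq_one_iff[OF _ _ g', of 2] by (simp add: \<phi>.hom_relator del: pi.H.nat_pow_Suc)
  then obtain \<psi> where \<psi>: "\<psi> \<in> hom ?G ?G" "\<And>w. w \<in> carrier F2 \<Longrightarrow> \<psi> (BSZ_map 2 w) = \<phi> w"
    by (rule one_relator_group_universal[OF _ pi.H.group_axioms \<phi>(1), rotated]) auto
  interpret \<psi>: group_hom ?G ?G \<psi> by unfold_locales (rule \<psi>)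
  have gens: "\<psi> z = z" "\<psi> y = y'" "\<psi> g = g2"
    using \<psi>(2) \<phi> g' by (simp_all add: y_def z_def g_def \<phi>.hom_commutator)
  let ?I = "\<psi> ` carrier ?G"
  have sub: "subgroup ?I ?G" by (rule \<psi>.img_is_subgroup)
  have I: "z \<in> ?I" "y' \<in> ?I" "g2 \<in> ?I" using gens by (metis imageI c)+
  \<comment> \<open>For surjectivity, \<open>g = g^-2 g^3\<close> is a product of conjugates of
    powers of \<open>g2\<close> by powers of \<open>z\<close>, hence in the image; then
    \<open>y = y' g2\<close> is as well.\<close>
  have "g [^]\<^bsub>?G\<^esub> (3::nat) = inv\<^bsub>?G\<^esub> z \<otimes>\<^bsub>?G\<^esub> g2 \<otimes>\<^bsub>?G\<^esub> z"
    using rel by (simp add: pi.H.m_assoc)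
  then have "g = inv\<^bsub>?G\<^esub> g2 \<otimes>\<^bsub>?G\<^esub> (inv\<^bsub>?G\<^esub> z \<otimes>\<^bsub>?G\<^esub> g2 \<otimes>\<^bsub>?G\<^esub> z)"
    using g3(2) by (metis pi.H.inv_cancel_left(1) c(3,4))
  moreover have "y = y' \<otimes>\<^bsub>?G\<^esub> g2" by (simp add: y'_def pi.H.m_assoc)
  ultimately have yI: "y \<in> ?I"
    using I sub by (simp add: subgroup.m_closed)
  have "subgroup {w \<in> carrier F2. BSZ_map 2 w \<in> ?I} F2"
    using sub by (intro F2.subgroupI)
      (auto simp: subgroup.m_closed subgroup.m_inv_closed subgroup.one_closed intro!: exI[of _ "\<one>\<^bsub>F2\<^esub>"])
  then have F2I: "carrier F2 \<subseteq> {w \<in> carrier F2. BSZ_map 2 w \<in> ?I}"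
    using I yI by (intro F2_subset_subgroup) (auto simp: y_def z_def)
  have "carrier ?G \<subseteq> ?I"
  proof
    fix x assume "x \<in> carrier ?G"
    then obtain w where "w \<in> carrier F2" "x = BSZ_map 2 w"
      using quotient_map_surj[of "{0, Suc 0}" "rel 2"] by (metis imageE)
    then show "x \<in> ?I" using subsetD[OF F2I, of w] by simp
  qed
  then have "\<psi> \<in> epi ?G ?G" using \<psi>(1) by (simp add: epi_iff_subset)
  moreover assume "hopfian ?G"
  ultimately have inj: "inj_on \<psi> (carrier ?G)" by (simp add: hopfian_def)
  have "\<psi> (pi.H.witness g z 1) = \<one>\<^bsub>?G\<^esub>"
    using pi.H.witness_square_eq_one[OF _ _ rel[unfolded g2_def]]
    by (simp add: \<psi>.hom_witness gens g2_def)
  then have "pi.H.witness g z 1 = \<one>\<^bsub>?G\<^esub>"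
    using inj by (metis \<psi>.hom_one inj_onD pi.H.one_closed pi.H.witness_closed c(2,3))
  then show False using BSZ_2_witness_nontrivial by (simp add: pi.hom_witness g_def z_def)
qed

section \<open>Exponential filling\<close>

definition shift :: "int \<Rightarrow> 'x \<times> int \<Rightarrow> 'x \<times> int" where
  "shift s q = (fst q, snd q + s)"

lemma shift_simps [simp]:
  "shift s (x, a) = (x, a + s)"
  "shift s (shift t q) = shift (s + t) q"
  "shift 0 q = q"
  by (auto simp: shift_def)

text \<open>The fibres are the lines over the points of \<open>'x\<close>. Because the action
  commutes with translations along them, displacement bounds add up in products and survive
  conjugation.\<close>

locale fibred_action = group_hom F perm_group \<phi>
  for F :: "('f, 'c) monoid_scheme" and \<phi> :: "'f \<Rightarrow> 'x \<times> int \<Rightarrow> 'x \<times> int" +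
  assumes equivariant: "f \<in> carrier F \<Longrightarrow> \<phi> f (shift s q) = shift s (\<phi> f q)"
begin

lemma action_mult [simp]:
  "u \<in> carrier F \<Longrightarrow> v \<in> carrier F \<Longrightarrow> \<phi> (u \<otimes>\<^bsub>F\<^esub> v) q = \<phi> u (\<phi> v q)"
  by simp

lemma action_inv [simp]:
  assumes "f \<in> carrier F"
  shows "\<phi> (inv\<^bsub>F\<^esub> f) (\<phi> f q) = q" "\<phi> f (\<phi> (inv\<^bsub>F\<^esub> f) q) = q"
proof -
  have "\<phi> (inv\<^bsub>F\<^esub> f \<otimes>\<^bsub>F\<^esub> f) q = q" "\<phi> (f \<otimes>\<^bsub>F\<^esub> inv\<^bsub>F\<^esub> f) q = q" using assms by simp_all
  then show "\<phi> (inv\<^bsub>F\<^esub> f) (\<phi> f q) = q" "\<phi> f (\<phi> (inv\<^bsub>F\<^esub> f) q) = q"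
    using assms by (simp_all only: action_mult G.inv_closed)
qed

text \<open>This serves as the filling function \<open>B\<close>: if the relator lies in
  \<open>bounded_shift 1\<close>, then the elements of area at most \<open>n\<close> lie in
  \<open>bounded_shift n\<close>.\<close>

definition bounded_shift :: "nat \<Rightarrow> 'f set" where
  "bounded_shift n = {f \<in> carrier F. \<forall>q. \<exists>s. \<bar>s\<bar> \<le> int n \<and> \<phi> f q = shift s q}"

lemma bounded_shiftE:
  assumes "f \<in> bounded_shift n"
  obtains s where "\<bar>s\<bar> \<le> int n" "\<phi> f q = shift s q"
  using assms unfolding bounded_shift_def by blast

lemma bounded_shift_closed: "f \<in> bounded_shift n \<Longrightarrow> f \<in> carrier F"
  by (simp add: bounded_shift_def)

lemma bounded_shift_mono: "m \<le> n \<Longrightarrow> bounded_shift m \<subseteq> bounded_shift n"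
  unfolding bounded_shift_def by (auto, meson of_nat_mono order_trans)

lemma bounded_shift_mult:
  assumes "u \<in> bounded_shift m" "v \<in> bounded_shift n"
  shows "u \<otimes>\<^bsub>F\<^esub> v \<in> bounded_shift (m + n)"
proof -
  have c: "u \<in> carrier F" "v \<in> carrier F" using assms bounded_shift_closed by auto
  have "\<exists>s. \<bar>s\<bar> \<le> int (m + n) \<and> \<phi> (u \<otimes>\<^bsub>F\<^esub> v) q = shift s q" for q
  proof -
    obtain s where s: "\<bar>s\<bar> \<le> int n" "\<phi> v q = shift s q" by (rule bounded_shiftE[OF assms(2)])
    obtain t where t: "\<bar>t\<bar> \<le> int m" "\<phi> u (shift s q) = shift t (shift s q)"
      by (rule bounded_shiftE[OF assms(1)])
    then show ?thesis using s c by (intro exI[of _ "t + s"]) (auto simp del: hom_mult)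
  qed
  then show ?thesis using c by (auto simp: bounded_shift_def)
qed

lemma bounded_shift_conj:
  assumes "u \<in> bounded_shift m" "f \<in> carrier F"
  shows "f \<otimes>\<^bsub>F\<^esub> u \<otimes>\<^bsub>F\<^esub> inv\<^bsub>F\<^esub> f \<in> bounded_shift m"
proof -
  have u: "u \<in> carrier F" using assms bounded_shift_closed by auto
  have "\<exists>s. \<bar>s\<bar> \<le> int m \<and> \<phi> (f \<otimes>\<^bsub>F\<^esub> u \<otimes>\<^bsub>F\<^esub> inv\<^bsub>F\<^esub> f) q = shift s q" for q
  proof -
    obtain s where s: "\<bar>s\<bar> \<le> int m" "\<phi> u (\<phi> (inv\<^bsub>F\<^esub> f) q) = shift s (\<phi> (inv\<^bsub>F\<^esub> f) q)"
      by (rule bounded_shiftE[OF assms(1)])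
    then have "\<phi> (f \<otimes>\<^bsub>F\<^esub> u \<otimes>\<^bsub>F\<^esub> inv\<^bsub>F\<^esub> f) q = shift s q"
      using assms(2) u by (simp del: hom_mult hom_inv add: equivariant)
    then show ?thesis using s by blast
  qed
  then show ?thesis using assms u by (auto simp: bounded_shift_def)
qed

lemma bounded_shift_inv:
  assumes "u \<in> bounded_shift m"
  shows "inv\<^bsub>F\<^esub> u \<in> bounded_shift m"
proof -
  have u: "u \<in> carrier F" using assms bounded_shift_closed by auto
  have "\<exists>s. \<bar>s\<bar> \<le> int m \<and> \<phi> (inv\<^bsub>F\<^esub> u) q = shift s q" for q
  proof -
    let ?q = "\<phi> (inv\<^bsub>F\<^esub> u) q"
    obtain s where s: "\<bar>s\<bar> \<le> int m" "\<phi> u ?q = shift s ?q"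
      by (rule bounded_shiftE[OF assms])
    then have "shift (- s) q = ?q" using u by (metis action_inv(2) add.left_inverse shift_simps(2,3))
    then show ?thesis using s by (intro exI[of _ "- s"]) auto
  qed
  then show ?thesis using u by (auto simp: bounded_shift_def)
qed

text \<open>The elements of bounded displacement, with any bound, form a normal subgroup.\<close>

lemma normal_closure_bounded_shift:
  assumes "r \<in> bounded_shift n" "u \<in> normal_closure F r"
  shows "\<exists>m. u \<in> bounded_shift m"
proof -
  let ?N = "{f. \<exists>m. f \<in> bounded_shift m}"
  have "\<one>\<^bsub>F\<^esub> \<in> bounded_shift 0" by (auto simp: bounded_shift_def intro: exI[of _ 0])
  then have "subgroup ?N F"
    using bounded_shift_inv bounded_shift_mult bounded_shift_closed
    by (intro G.subgroupI) blast+
  then have "?N \<lhd> F"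
    using bounded_shift_conj unfolding G.normal_inv_iff by blast
  then have "normal_closure F r \<subseteq> ?N" using assms(1) by (intro normal_closure_minimal) auto
  then show ?thesis using assms(2) by blast
qed

end

text \<open>The value off the dyadic rationals is the junk value 0.\<close>

definition dyadic_denom :: "rat \<Rightarrow> int" where
  "dyadic_denom x = (if \<exists>n. x * 2 ^ n \<in> \<int> then 2 ^ (LEAST n. x * 2 ^ n \<in> \<int>) else 0)"

lemma dyadic_denom_Ints: "x \<in> \<int> \<Longrightarrow> dyadic_denom x = 1"
proof -
  assume x: "x \<in> \<int>"
  then have "(LEAST n. x * 2 ^ n \<in> \<int>) = 0" by (intro Least_equality) auto
  then show ?thesis using x by (auto simp: dyadic_denom_def intro: exI[of _ 0])
qed

text \<open>The exponents clearing the denominator of \<open>x / 2\<close> are those for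
  \<open>x\<close> raised by one, since the exponent 0 is excluded. The junk value satisfies the
  equation too, as 0 is its own double.\<close>

lemma dyadic_denom_half:
  assumes "x / 2 \<notin> \<int>"
  shows "dyadic_denom (x / 2) = 2 * dyadic_denom x"
proof -
  have Suc: "x / 2 * 2 ^ Suc n = x * 2 ^ n" for n by simp
  have ex: "(\<exists>n. x / 2 * 2 ^ n \<in> \<int>) \<longleftrightarrow> (\<exists>n. x * 2 ^ n \<in> \<int>)"
    using assms Suc by (metis mult.right_neutral not0_implies_Suc power_0)
  show ?thesis
  proof (cases "\<exists>n. x / 2 * 2 ^ n \<in> \<int>")
    case True
    then obtain n where "x / 2 * 2 ^ n \<in> \<int>" ..
    then have "(LEAST n. x / 2 * 2 ^ n \<in> \<int>) = Suc (LEAST n. x * 2 ^ n \<in> \<int>)"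
      using Least_Suc[of "\<lambda>n. x / 2 * 2 ^ n \<in> \<int>" n] assms unfolding Suc by simp
    then show ?thesis using True ex by (simp add: dyadic_denom_def)
  next
    case False
    then show ?thesis using ex by (simp add: dyadic_denom_def)
  qed
qed

lemma Ints_add_iff: "(a :: 'a :: ring_1) \<in> \<int> \<Longrightarrow> x + a \<in> \<int> \<longleftrightarrow> x \<in> \<int>"
  by (metis Ints_add Ints_diff add_diff_cancel_right')

lemma dyadic_denom_add_1 [simp]: "dyadic_denom (x + 1) = dyadic_denom x"
proof -
  have "(x + 1) * 2 ^ n \<in> \<int> \<longleftrightarrow> x * 2 ^ n \<in> \<int>" for n
    by (simp add: distrib_right Ints_add_iff)
  then show ?thesis by (simp add: dyadic_denom_def)
qed

lemma dyadic_denom_inverse_power: "dyadic_denom (1 / 2 ^ n) = 2 ^ n"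
proof (induction n)
  case (Suc n)
  have "(1 :: rat) / 2 ^ Suc n \<notin> \<int>"
  proof
    assume "(1 :: rat) / 2 ^ Suc n \<in> \<int>"
    then obtain k where k: "(1 :: rat) / 2 ^ Suc n = of_int k" by (rule Ints_cases)
    have "(0 :: rat) < of_int k" unfolding k[symmetric] by simp
    moreover have "of_int k < (1 :: rat)"
      unfolding k[symmetric] using one_less_power[of "2 :: rat" "Suc n"] by simp
    ultimately show False by simp
  qed
  then show ?case using dyadic_denom_half[of "1 / 2 ^ n"] Suc by (simp add: mult.commute)
qed (simp add: dyadic_denom_Ints)

section \<open>The witnesses as words in \<open>g\<close> and \<open>z\<close>\<close>

context group
begin

lemma word_value_replicate: "u \<in> carrier G \<Longrightarrow> word_value G (\<lambda>u. u) (replicate n u) = u [^] n"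
  by (induction n) (simp_all add: pow_commute)

lemma witness_word:
  assumes "g \<in> carrier G" "z \<in> carrier G"
  shows "\<exists>us\<in>lists {g, inv g, z, inv z}. length us = 4 * n + 4 \<and>
    word_value G (\<lambda>u. u) us = witness g z n"
proof -
  define us where "us = [inv g] @ replicate n (inv z) @ [inv g] @ replicate n z @ [g] @
    replicate n (inv z) @ [g] @ replicate n z"
  let ?S = "{g, inv g, z, inv z}"
  have S: "(\<lambda>u. u) ` ?S \<subseteq> carrier G" using assms by auto
  have r: "replicate n u \<in> lists ?S" if "u \<in> ?S" for u using that by auto
  have us: "us \<in> lists ?S" unfolding us_def by auto
  have "word_value G (\<lambda>u. u) us = inv g \<otimes> (inv z [^] n \<otimes> (inv g \<otimes> (z [^] n \<otimes>
     (g \<otimes> (inv z [^] n \<otimes> (g \<otimes> z [^] n))))))"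
    unfolding us_def
    using assms by (simp add: word_value_append[OF S] r word_value_replicate)
  also have "\<dots> = witness g z n"
    using assms by (simp add: witness_def commutator_def inv_mult_group m_assoc nat_pow_inv)
  finally show ?thesis using us by (intro bexI[of _ us]) (auto simp: us_def)
qed

end

text \<open>
  On the first coordinate \<open>g\<close> and \<open>z\<close> act by \<open>x \<mapsto> x + 1\<close> and \<open>x \<mapsto> x / 2\<close>. The second coordinate
  moves by the denominator of \<open>x\<close>, which nearly cancels in the relator but not in the witnesses.
\<close>

lemma BSZ_1_fibred_action:
  obtains \<phi> :: "nat letter list \<Rightarrow> rat \<times> int \<Rightarrow> rat \<times> int"
  where "fibred_action F2 \<phi>" "\<And>x a. \<phi> gen_z (x, a) = (x / 2, a)"
    "\<And>x a. \<phi> gen_g (x, a) = (x + 1, a - dyadic_denom x + dyadic_denom ((x + 1) / 2))"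
    "rel 1 \<in> fibred_action.bounded_shift F2 \<phi> 1"
proof -
  \<comment> \<open>On the first coordinate \<open>y\<close> is inverse to \<open>g\<close>, so
    \<open>y g\<close> preserves fibres. Only \<open>y\<close> is given a displacement by hand; that
    of \<open>g\<close> results from computing \<open>[z, y]\<close>.\<close>
  define y :: "rat \<times> int \<Rightarrow> rat \<times> int" where "y = (\<lambda>(x, a). (x - 1, a - dyadic_denom x))"
  define z :: "rat \<times> int \<Rightarrow> rat \<times> int" where "z = (\<lambda>(x, a). (x / 2, a))"
  define g :: "rat \<times> int \<Rightarrow> rat \<times> int" where
    "g = (\<lambda>(x, a). (x + 1, a - dyadic_denom x + dyadic_denom ((x + 1) / 2)))"
  interpret P: group "perm_group :: (rat \<times> int \<Rightarrow> rat \<times> int) monoid" by (rule group_perm_group)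
  have minus_1: "dyadic_denom (x - 1) = dyadic_denom x" for x
    using dyadic_denom_add_1[of "x - 1"] by simp
  have "bij y"
    by (rule bij_of_inverse[of "\<lambda>(x, a). (x + 1, a + dyadic_denom x)"]) (auto simp: y_def minus_1)
  moreover have "bij z" by (rule bij_of_inverse[of "\<lambda>(x, a). (2 * x, a)"]) (auto simp: z_def)
  moreover have "bij g"
    by (rule bij_of_inverse[of "\<lambda>(x, a). (x - 1, a + dyadic_denom x - dyadic_denom (x / 2))"])
      (auto simp: g_def minus_1)
  ultimately have bij [simp]: "bij y" "bij z" "bij g" by blast+
  obtain \<phi> where \<phi>: "\<phi> \<in> hom F2 perm_group" "\<phi> gen_y = y" "\<phi> gen_z = z"
    by (rule F2_hom[OF P.group_axioms, of y z]) auto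
  interpret \<phi>: group_hom F2 perm_group \<phi> by unfold_locales (rule \<phi>)
  have half: "(x - 1) / 2 = (x + 1) / 2 - 1" for x :: rat by (simp add: field_simps)
  have "commutator perm_group z y = g"
  proof (rule P.commutator_eqI)
    show "y \<otimes>\<^bsub>perm_group\<^esub> z \<otimes>\<^bsub>perm_group\<^esub> g = z \<otimes>\<^bsub>perm_group\<^esub> y"
      by (auto simp: fun_eq_iff y_def z_def g_def half)
  qed auto
  then have g: "\<phi> gen_g = g" using \<phi> by (simp add: \<phi>.hom_commutator)
  \<comment> \<open>The elements commuting with all shifts form a subgroup, so checking
    \<open>y\<close> and \<open>z\<close> suffices.\<close>
  have E: "carrier F2 \<subseteq> {f \<in> carrier F2. \<forall>s q. \<phi> f (shift s q) = shift s (\<phi> f q)}" (is "_ \<subseteq> ?E")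
  proof -
    have inv: "\<phi> (inv\<^bsub>F2\<^esub> f) (\<phi> f q) = q" "\<phi> f (\<phi> (inv\<^bsub>F2\<^esub> f) q) = q"
      if f: "f \<in> carrier F2" for f q
    proof -
      have "\<phi> (inv\<^bsub>F2\<^esub> f \<otimes>\<^bsub>F2\<^esub> f) q = q" "\<phi> (f \<otimes>\<^bsub>F2\<^esub> inv\<^bsub>F2\<^esub> f) q = q"
        using f by (simp_all del: \<phi>.hom_mult)
      then show "\<phi> (inv\<^bsub>F2\<^esub> f) (\<phi> f q) = q" "\<phi> f (\<phi> (inv\<^bsub>F2\<^esub> f) q) = q"
        using f by (simp_all only: \<phi>.hom_mult F2.inv_closed perm_group_simps comp_apply)
    qed
    have "subgroup ?E F2"
    proof (rule F2.subgroupI)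
      show "?E \<noteq> {}" by (auto intro!: exI[of _ "\<one>\<^bsub>F2\<^esub>"])
      fix f assume f: "f \<in> ?E"
      have "\<phi> (inv\<^bsub>F2\<^esub> f) (shift s q) = shift s (\<phi> (inv\<^bsub>F2\<^esub> f) q)" for s q
      proof -
        have f': "f \<in> carrier F2" using f by simp
        let ?q = "\<phi> (inv\<^bsub>F2\<^esub> f) q"
        have "\<phi> f (shift s ?q) = shift s (\<phi> f ?q)" using f by blast
        then have "\<phi> (inv\<^bsub>F2\<^esub> f) (shift s q) = \<phi> (inv\<^bsub>F2\<^esub> f) (\<phi> f (shift s ?q))"
          by (simp only: inv(2)[OF f'])
        then show ?thesis by (simp only: inv(1)[OF f'])
      qed
      then show "inv\<^bsub>F2\<^esub> f \<in> ?E" using f by blast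
    next
      fix f f' assume f: "f \<in> ?E" and f': "f' \<in> ?E"
      then have c: "f \<in> carrier F2" "f' \<in> carrier F2" by blast+
      have "\<phi> f (\<phi> f' (shift s q)) = shift s (\<phi> f (\<phi> f' q))" for s q
      proof -
        have "\<phi> f (shift s r) = shift s (\<phi> f r)" "\<phi> f' (shift s r) = shift s (\<phi> f' r)" for s r
          using f f' by blast+
        then show ?thesis by (simp only:)
      qed
      then show "f \<otimes>\<^bsub>F2\<^esub> f' \<in> ?E"
        using c by (simp only: \<phi>.hom_mult perm_group_simps comp_apply F2.m_closed mem_Collect_eq) blast
    qed auto
    then show ?thesis
      using \<phi> by (intro F2_subset_subgroup) (auto simp: y_def z_def)
  qed
  interpret A: fibred_action F2 \<phi>
  proof
    fix f s q assume "f \<in> carrier F2"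
    then show "\<phi> f (shift s q) = shift s (\<phi> f q)" using subsetD[OF E] by blast
  qed
  \<comment> \<open>This is the displacement of \<open>y g\<close>. Halving \<open>x + 1\<close>
    doubles the denominator, so \<open>c x = 0\<close>, unless \<open>(x + 1) / 2\<close> is an
    integer; then both denominators are 1 and \<open>c x = 1 - 2\<close>.\<close>
  define c where "c x = dyadic_denom ((x + 1) / 2) - 2 * dyadic_denom x" for x
  have c: "c x \<in> {-1, 0}" for x
  proof (cases "(x + 1) / 2 \<in> \<int>")
    case True
    then have "2 * ((x + 1) / 2) - 1 \<in> \<int>" by (intro Ints_diff Ints_mult) auto
    moreover have "2 * ((x + 1) / 2) - 1 = x" by (simp add: field_simps)
    ultimately have "x \<in> \<int>" by metis
    then show ?thesis using True by (simp add: c_def dyadic_denom_Ints)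
  next
    case False
    then show ?thesis using dyadic_denom_half[of "x + 1"] by (simp add: c_def)
  qed
  \<comment> \<open>As \<open>z\<close> only changes the point at which \<open>c\<close> is
    evaluated, the relator displaces by a difference of two values of \<open>c\<close>, which is at
    most 1 in size.\<close>
  define R :: "rat \<times> int \<Rightarrow> rat \<times> int" where "R = (\<lambda>(x, a). (x, a + c (x / 2) - c x))"
  have "bij R"
    by (rule bij_of_inverse[of "\<lambda>(x, a). (x, a - c (x / 2) + c x)"]) (auto simp: R_def)
  have yg: "y (g (x, a)) = (x, a + c x)" for x a by (simp add: y_def g_def c_def)
  have "\<phi> (rel 1) = commutator perm_group (y \<circ> g) z"
    using \<phi> g by (simp add: F2.relator_def \<phi>.hom_commutator[of "_ \<otimes>\<^bsub>F2\<^esub> _"])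
  also have "\<dots> = R"
  proof (rule P.commutator_eqI)
    have "z (y (g (R q))) = y (g (z q))" for q
      by (cases q) (simp add: yg R_def z_def)
    then show "z \<otimes>\<^bsub>perm_group\<^esub> (y \<circ> g) \<otimes>\<^bsub>perm_group\<^esub> R = (y \<circ> g) \<otimes>\<^bsub>perm_group\<^esub> z"
      by (simp add: fun_eq_iff)
  qed (use \<open>bij R\<close> in \<open>auto intro: bij_comp\<close>)
  finally have "\<phi> (rel 1) (x, a) = shift (c (x / 2) - c x) (x, a)" for x a
    by (simp add: R_def)
  moreover have "\<bar>c (x / 2) - c x\<bar> \<le> int 1" for x using c[of x] c[of "x / 2"] by auto
  ultimately have "rel 1 \<in> A.bounded_shift 1" unfolding A.bounded_shift_def by force
  then show thesis
    using that[OF A.fibred_action_axioms] \<phi> g by (simp add: z_def g_def)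
qed

text \<open>With \<open>h = z^-n g z^n\<close>, both \<open>g h\<close> and \<open>h g\<close> send
  \<open>(0, 0)\<close> into the fibre over \<open>2^n + 1\<close>, but to heights \<open>2\<close>
  and \<open>2^n + 1\<close>. The large height arises when \<open>h\<close> acts over 1: there
  \<open>g\<close> is applied at \<open>1 / 2^n\<close>, where the denominators are
  \<open>2^n\<close> and \<open>2^(n+1)\<close>.\<close>

lemma witness_shift:
  fixes F (structure) and \<phi> :: "'f \<Rightarrow> rat \<times> int \<Rightarrow> rat \<times> int"
  assumes act: "fibred_action F \<phi>"
    and F: "g \<in> carrier F" "z \<in> carrier F"
    and z: "\<And>x a. \<phi> z (x, a) = (x / 2, a)"
    and g: "\<And>x a. \<phi> g (x, a) = (x + 1, a - dyadic_denom x + dyadic_denom ((x + 1) / 2))"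
    and n: "n > 0" and w: "group.witness F g z n \<in> fibred_action.bounded_shift F \<phi> C"
  shows "2 ^ n \<le> int C + 1"
proof -
  interpret fibred_action F \<phi> by (rule act)
  let ?Z = "z [^]\<^bsub>F\<^esub> n"
  define h where "h = inv\<^bsub>F\<^esub> ?Z \<otimes>\<^bsub>F\<^esub> g \<otimes>\<^bsub>F\<^esub> ?Z"
  have h: "h \<in> carrier F" using F by (simp add: h_def)
  have Z: "\<phi> ?Z (x, a) = (x / 2 ^ n, a)" for x a
    using F z by (induction n arbitrary: x a) (simp_all add: mult.commute)
  have Zinv: "\<phi> (inv\<^bsub>F\<^esub> ?Z) (x, a) = (x * 2 ^ n, a)" for x a
    using action_inv(1)[of ?Z "(x * 2 ^ n, a)"] F by (simp add: Z)
  have ph: "\<phi> h q = \<phi> (inv\<^bsub>F\<^esub> ?Z) (\<phi> g (\<phi> ?Z q))" for q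
    using F by (simp add: h_def del: hom_mult hom_inv hom_nat_pow)
  have nonint: "(1 / 2 ^ n + 1) / 2 \<notin> (\<int> :: rat set)"
  proof
    assume "(1 / 2 ^ n + 1) / 2 \<in> (\<int> :: rat set)"
    then have "2 * ((1 / 2 ^ n + 1) / 2) - 1 \<in> (\<int> :: rat set)" by (intro Ints_diff Ints_mult) auto
    moreover have "2 * ((1 / 2 ^ n + 1) / 2) - 1 = (1 / 2 ^ n :: rat)" by (simp add: field_simps)
    ultimately have "dyadic_denom (1 / 2 ^ n) = 1" by (intro dyadic_denom_Ints) metis
    then show False using n by (simp add: dyadic_denom_inverse_power)
  qed
  have h0: "\<phi> h (0, a) = (2 ^ n, a + 1)" for a
  proof -
    have "dyadic_denom (1 / 2) = 2" using dyadic_denom_inverse_power[of 1] by simp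
    then show ?thesis by (simp add: ph Z Zinv g dyadic_denom_Ints)
  qed
  have h1: "\<phi> h (1, a) = (1 + 2 ^ n, a + 2 ^ n)" for a
  proof -
    have "dyadic_denom ((1 / 2 ^ n + 1) / 2) = 2 * 2 ^ n"
      using dyadic_denom_half[OF nonint] by (simp add: dyadic_denom_inverse_power)
    then show ?thesis by (simp add: ph Z Zinv g dyadic_denom_inverse_power distrib_right)
  qed
  have g2: "\<phi> g (2 ^ n, a) = (2 ^ n + 1, a + 1)" for a
  proof -
    have "dyadic_denom ((2 ^ n + 1) / 2) = 2"
    proof (subst dyadic_denom_half)
      show "((2 :: rat) ^ n + 1) / 2 \<notin> \<int>"
      proof
        assume "((2 :: rat) ^ n + 1) / 2 \<in> \<int>"
        then obtain k where "((2 :: rat) ^ n + 1) / 2 = of_int k" by (rule Ints_cases)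
        then have "(of_int (2 ^ n + 1) :: rat) = of_int (2 * k)" by (simp add: field_simps)
        then have "(2 ^ n + 1 :: int) = 2 * k" by (simp only: of_int_eq_iff)
        then have "even (2 ^ n + 1 :: int)" by simp
        then show False using n by simp
      qed
    qed (simp add: dyadic_denom_Ints)
    then show ?thesis by (simp add: g dyadic_denom_Ints)
  qed
  have g0: "\<phi> g (0, a) = (1, a + 1)" for a
    using h0[of a] dyadic_denom_inverse_power[of 1] by (simp add: g dyadic_denom_Ints)
  obtain s where s: "\<bar>s\<bar> \<le> int C" "\<phi> (G.witness g z n) (0, 0) = shift s (0, 0)"
    by (rule bounded_shiftE[OF w])
  have wF: "G.witness g z n \<in> carrier F" using F by simp
  have "h \<otimes>\<^bsub>F\<^esub> g \<otimes>\<^bsub>F\<^esub> G.witness g z n = g \<otimes>\<^bsub>F\<^esub> h"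
    unfolding G.witness_def h_def[symmetric] using F h by (intro G.mult_commutator)
  then have "\<phi> h (\<phi> g (\<phi> (G.witness g z n) (0, 0))) = \<phi> g (\<phi> h (0, 0))"
    using action_mult[OF F(1) h] action_mult[OF G.m_closed[OF h F(1)] wF] action_mult[OF h F(1)]
    by metis
  then have "s + 1 + 2 ^ n = 2" by (simp add: s g0 h0 h1 g2)
  then show ?thesis using s(1) by simp
qed

section \<open>Exponential against quadratic area\<close>

theorem BSZ_1_not_automatic: "\<not> automatic (BSZ 1)"
proof
  assume "automatic (BSZ 1)"
  then obtain A :: "nat set" and p and W :: "(nat, nat) automaton" and M
    where str: "automatic_structure (BSZ 1) A p W M" by (auto simp: automatic_def)
  interpret pi: group_hom F2 "BSZ 1" "BSZ_map 1" by (rule group_hom_BSZ_map)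
  obtain \<phi> :: "nat letter list \<Rightarrow> rat \<times> int \<Rightarrow> rat \<times> int"
    where \<phi>: "fibred_action F2 \<phi>" "\<And>x a. \<phi> gen_z (x, a) = (x / 2, a)"
      "\<And>x a. \<phi> gen_g (x, a) = (x + 1, a - dyadic_denom x + dyadic_denom ((x + 1) / 2))"
      "rel 1 \<in> fibred_action.bounded_shift F2 \<phi> 1"
    by (rule BSZ_1_fibred_action) (rule that; assumption)
  interpret fibred_action F2 \<phi> by (rule \<phi>(1))
  interpret automatic_filling F2 "BSZ 1" A p W M "BSZ_map 1" bounded_shift
  proof
    show "automatic_structure (BSZ 1) A p W M" by (rule str)
    show "BSZ_map 1 \<in> hom F2 (BSZ 1)" by (rule pi.homh)
    show "BSZ_map 1 ` carrier F2 = carrier (BSZ 1)" by (rule quotient_map_surj)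
    show "\<exists>m. u \<in> bounded_shift m" if "u \<in> kernel F2 (BSZ 1) (BSZ_map 1)" for u
    proof (rule normal_closure_bounded_shift[OF \<phi>(4)])
      show "u \<in> normal_closure F2 (rel 1)"
        using that quotient_map_eq_one_iff[of "rel 1" "{0, Suc 0}" u] by (simp add: kernel_def)
    qed
  qed (use bounded_shift_mono bounded_shift_mult bounded_shift_conj in blast)+
  let ?X = "{gen_g, inv\<^bsub>F2\<^esub> gen_g, gen_z, inv\<^bsub>F2\<^esub> gen_z}"
  have X: "finite ?X" "?X \<subseteq> carrier F2" by auto
  obtain C where C: "\<And>us. us \<in> lists ?X \<Longrightarrow> word_value F2 (\<lambda>u. u) us \<in> kernel F2 (BSZ 1) (BSZ_map 1) \<Longrightarrow>
      word_value F2 (\<lambda>u. u) us \<in> bounded_shift (C * (length us + 1)^2)"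
    using quadratic_filling[OF X] by blast
  \<comment> \<open>The witness has a word of length \<open>4 * n + 4\<close>, which bounds its
    displacement quadratically from above, while \<open>witness_shift\<close> forces the bound to be
    at least \<open>2^n - 1\<close>.\<close>
  have growth: "2 ^ n \<le> real C * (4 * real n + 5)^2 + 1" if n: "n > 0" for n
  proof -
    obtain us where us: "us \<in> lists ?X" "length us = 4 * n + 4"
        "word_value F2 (\<lambda>u. u) us = F2.witness gen_g gen_z n"
      using F2.witness_word[of gen_g gen_z n] by auto
    have "pi.H.witness (BSZ_map 1 gen_g) (BSZ_map 1 gen_z) n = \<one>\<^bsub>BSZ 1\<^esub>"
    proof (rule pi.H.witness_eq_one)
      show g: "BSZ_map 1 gen_g \<in> carrier (BSZ 1)" and "BSZ_map 1 gen_z \<in> carrier (BSZ 1)"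
        by (rule pi.hom_closed, simp)+
      have "BSZ_map 1 gen_g [^]\<^bsub>BSZ 1\<^esub> (1::nat) = BSZ_map 1 gen_g"
        by (rule pi.H.nat_pow_eone[OF g])
      then show "BSZ_map 1 gen_g \<otimes>\<^bsub>BSZ 1\<^esub> BSZ_map 1 gen_z =
          BSZ_map 1 gen_z \<otimes>\<^bsub>BSZ 1\<^esub> BSZ_map 1 gen_g [^]\<^bsub>BSZ 1\<^esub> (2::nat)"
        using BSZ_relation[of 1] by (simp only: Suc_1)
    qed
    then have "F2.witness gen_g gen_z n \<in> kernel F2 (BSZ 1) (BSZ_map 1)"
      by (simp only: kernel_def pi.hom_witness mem_Collect_eq gens_closed F2.commutator_closed
        F2.witness_closed)
    then have "F2.witness gen_g gen_z n \<in> bounded_shift (C * (length us + 1)^2)"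
      using C[OF us(1)] unfolding us(3) by blast
    then have "2 ^ n \<le> int (C * (length us + 1)^2) + 1"
      by (intro witness_shift[OF \<phi>(1) _ _ \<phi>(2,3) n]) simp_all
    also have "\<dots> = int (C * (4 * n + 5)^2 + 1)" using us(2) by simp
    finally have "real_of_int (2 ^ n) \<le> real_of_int (int (C * (4 * n + 5)^2 + 1))"
      by (simp only: of_int_le_iff)
    then show ?thesis by simp
  qed
  have "eventually (\<lambda>n. real C * (4 * real n + 5)^2 + 1 < 2 ^ n) at_top"
    by real_asymp
  then have "eventually (\<lambda>n. n > 0 \<and> real C * (4 * real n + 5)^2 + 1 < 2 ^ n) at_top"
    using eventually_gt_at_top[of 0] by eventually_elim auto
  then obtain n where "n > 0" "real C * (4 * real n + 5)^2 + 1 < 2 ^ n"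
    unfolding eventually_at_top_linorder by (meson order_refl)
  with growth[of n] show False by linarith
qed

theorem corollary1p4:
  shows "\<forall>P \<in> {hopfian, residually_finite, automatic}.
    (\<exists>S :: nat set. finite S \<and>
       (\<exists>u\<in>carrier (free_group S). \<exists>v\<in>carrier (free_group S).
          \<not> P (one_relator_group S (commutator (free_group S) u v)))) \<and>
    (\<exists>S :: nat set. finite S \<and>
       (\<exists>r\<in>derived (free_group S) (carrier (free_group S)).
          \<not> P (one_relator_group S r)))"
proof
  fix P :: "nat letter list set monoid \<Rightarrow> bool"
  assume "P \<in> {hopfian, residually_finite, automatic}"
  \<comment> \<open>The first two properties fail for \<open>m = 2\<close>, automaticity for
    \<open>m = 1\<close>.\<close>
  then obtain m where m: "\<not> P (BSZ m)"
    using BSZ_2_not_hopfian BSZ_2_not_residually_finite BSZ_1_not_automatic by blast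
  let ?u = "gen_y \<otimes>\<^bsub>F2\<^esub> gen_g [^]\<^bsub>F2\<^esub> m"
  have u: "?u \<in> carrier F2" by simp
  \<comment> \<open>The generators of \<open>derived\<close> have the form
    \<open>h1 h2 h1^-1 h2^-1\<close>, so the other commutator convention is matched by taking the
    inverses of \<open>?u\<close> and \<open>gen_z\<close> for \<open>h1\<close> and
    \<open>h2\<close>.\<close>
  have "rel m = inv\<^bsub>F2\<^esub> ?u \<otimes>\<^bsub>F2\<^esub> inv\<^bsub>F2\<^esub> gen_z \<otimes>\<^bsub>F2\<^esub> inv\<^bsub>F2\<^esub> (inv\<^bsub>F2\<^esub> ?u) \<otimes>\<^bsub>F2\<^esub> inv\<^bsub>F2\<^esub> (inv\<^bsub>F2\<^esub> gen_z)"
    by (simp add: F2.relator_def commutator_def)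
  moreover have "inv\<^bsub>F2\<^esub> ?u \<in> carrier F2" "inv\<^bsub>F2\<^esub> gen_z \<in> carrier F2" by simp_all
  ultimately have "rel m \<in> derived F2 (carrier F2)"
    unfolding derived_def by (intro generate.incl) blast
  moreover have "rel m = commutator F2 ?u gen_z" by (simp add: F2.relator_def)
  moreover have "finite {0, Suc 0}" by simp
  ultimately show "(\<exists>S :: nat set. finite S \<and>
       (\<exists>u\<in>carrier (free_group S). \<exists>v\<in>carrier (free_group S).
          \<not> P (one_relator_group S (commutator (free_group S) u v)))) \<and>
    (\<exists>S :: nat set. finite S \<and>
       (\<exists>r\<in>derived (free_group S) (carrier (free_group S)).
          \<not> P (one_relator_group S r)))"
    using m u gens_closed(2) by metis
qed

end
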